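(* Let $\mathcal{A}\in\mathbb{R}^{n_1\times n_2\times n_3\times\cdots\times n_m}$ have nonzero horizontal slices $\mathcal{A}(1),\dots,\mathcal{A}(n_1)$, and let $\mathcal{B}\in\mathbb{R}^{n_1\times l\times n_3\times\cdots\times n_m}$ be such that $\mathcal{A}*_L\mathcal{X}=\mathcal{B}$ has a solution $\mathcal X\in\mathbb{R}^{n_2\times l\times n_3\times\cdots\times n_m}$. Let $\lambda,\varepsilon,t>0$ and for $\mathcal{X}\in\mathbb{R}^{n_2\times l\times n_3\times\cdots\times n_m}$ let $$f(\mathcal{X})=\sum_{i_1,\dots,i_m}\lambda\log\left(1+\frac{|\mathcal{X}_{i_1,\dots,i_m}|}{\varepsilon}\right)+\frac12\|\mathcal{X}\|_F^2 ,$$ the sum being over all entries of $\mathcal{X}$. Let $\hat{\mathcal{X}}$ be the solution of $\min_{\mathcal{X}} f(\mathcal{X})$ subject to $\mathcal{A}*_L\mathcal{X}=\mathcal{B}$. Let $(\mathcal{Z}^{(k)},\mathcal{X}^{(k)})_{k\ge0}$ be generated by the LSP regularized Kaczmarz iteration (described in the context), where the indices $i(k)$ are chosen independently at random with the probability of $i(k)=j$ proportional to $\|\mathcal{A}(j)\|_F^2$, $j\in\{1,\dots,n_1\}$. Let $\nu>0$ be a constant such that $$D_{f,\mathcal{Z}}(\mathcal{X},\hat{\mathcal{X}})\le\frac1\nu\|\mathcal{A}*_L(\mathcal{X}-\hat{\mathcal{X}})\|_F^2$$ for all $\mathcal{X}$ and all $\mathcal{Z}\in\partial f(\mathcal{X})\cap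 R(\mathcal{A})$ with $D_{f,\mathcal{Z}}(\mathcal{X},\hat{\mathcal{X}})\le D_{f,\mathcal{Z}^{(0)}}(\mathcal{X}^{(0)},\hat{\mathcal{X}})$. If $\sqrt{\lambda}<\varepsilon$ and $$0<\frac{\nu t}{\|\mathcal{A}\|_F^2}\left(1-\frac{t\rho\varepsilon^2}{2\varepsilon^2-2\lambda}\right)<1,$$ then $\mathcal{X}^{(k)}$ converges linearly to $\hat{\mathcal{X}}$ in expectation. Specifically, for every $k\ge0$, $$\mathbb{E}\left[D_{f,\mathcal{Z}^{(k+1)}}(\mathcal{X}^{(k+1)},\hat{\mathcal{X}})\right]\le\left(1-\frac{\nu t}{\|\mathcal{A}\|_F^2}\left(1-\frac{t\rho\varepsilon^2}{2\varepsilon^2-2\lambda}\right)\right)\mathbb{E}\left[D_{f,\mathcal{Z}^{(k)}}(\mathcal{X}^{(k)},\hat{\mathcal{X}})\right],$$ and therefore $$\mathbb{E}\|\mathcal{X}^{(k)}-\hat{\mathcal{X}}\|_F^2\le\left[\frac{2\varepsilon^2}{\varepsilon^2-\lambda}D_{f,\mathcal{Z}^{(0)}}(\mathcal{X}^{(0)},\hat{\mathcal{X}})\right]\left(1-\frac{\nu t}{\|\mathcal{A}\|_F^2}\left(1-\frac{t\rho\varepsilon^2}{2\varepsilon^2-2\lambda}\right)\right)^k.$$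
   Context: Let $m\ge 3$. For invertible matrices $U_{n_i}\in\mathbb{C}^{n_i\times n_i}$, $i=3,\dots,m$, the linear transform $L$ acts on $m$-th order tensors whose last $m-2$ dimensions are $n_3,\dots,n_m$ (first two dimensions arbitrary) by $L(\mathcal{A})=\mathcal{A}\times_3U_{n_3}\times_4\cdots\times_mU_{n_m}=:\mathcal{A}_L$, where $\times_i$ is the mode-$i$ product (the mode-$i$ unfolding of $\mathcal{A}\times_iU$ is $U$ times the mode-$i$ unfolding of $\mathcal{A}$). It is assumed that there is a constant $\rho>0$ such that, with $K=U_{n_m}\otimes U_{n_{m-1}}\otimes\cdots\otimes U_{n_3}$, one has $KK^*=K^*K=\rho I$. The facewise product $\mathcal{A}\Delta\mathcal{B}$ multiplies corresponding frontal slices: $(\mathcal{A}\Delta\mathcal{B})(:,:,i_3,\dots,i_m)=\mathcal{A}(:,:,i_3,\dots,i_m)\,\mathcal{B}(:,:,i_3,\dots,i_m)$. The $L$-based t-product is $\mathcal{A}*_L\mathcal{B}=L^{-1}(\mathcal{A}_L\Delta\mathcal{B}_L)$; $L$ is such that $*_L$ maps pairs of real tensors to real tensors. The conjugate transpose $\mathcal{A}^*$ is defined by $(\mathcal{A}^* )_L(:,:,i_3,\dots,i_m)=(\mathcal{A}_L(:,:,i_3,\dots,i_m))^*$. $\langle\cdot,\cdot\rangle$ and $\|\cdot\|_F$ are the entrywise inner product and Frobenius norm. $\mathcal{A}(i)$ denotes the $i$-th horizontal slice $\mathcal{A}(i,:,\dots,:)$, of size $1\times n_2\times n_3\times\cdots\times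 n_m$ (similarly for $\mathcal{B}(i)$). The row space is $R(\mathcal{A})=\{\mathcal{A}^**_L\mathcal{Y}:\mathcal{Y}\in\mathbb{R}^{n_1\times l\times n_3\times\cdots\times n_m}\}$. $\partial f(\mathcal{X})=\{\mathcal{X}^*: f(\mathcal{Y})\ge f(\mathcal{X})+\langle\mathcal{X}^*,\mathcal{Y}-\mathcal{X}\rangle\ \forall\mathcal{Y}\}$ (here $\mathcal X^*$ denotes a subgradient). For convex $f$ and $\mathcal{Z}\in\partial f(\mathcal{X})$ the Bregman distance is $D_{f,\mathcal{Z}}(\mathcal{X},\mathcal{Y})=f(\mathcal{Y})-f(\mathcal{X})-\langle\mathcal{Z},\mathcal{Y}-\mathcal{X}\rangle$. Standing assumption: $\partial f(\hat{\mathcal{X}})\cap R(\mathcal{A})\neq\emptyset$ for the optimal solution $\hat{\mathcal{X}}$. With $\mathrm{LSP}(\mathcal{X})=\sum_{i_1,\dots,i_m}\log(1+|\mathcal{X}_{i_1,\dots,i_m}|/\varepsilon)$, define $\mathrm{prox}_{\lambda\mathrm{LSP}}(\mathcal{Z})=\operatorname{argmin}_{\mathcal{X}}\lambda\,\mathrm{LSP}(\mathcal{X})+\frac12\|\mathcal{X}-\mathcal{Z}\|_F^2$. LSP regularized Kaczmarz iteration: choose (deterministically) $\mathcal{Z}^{(0)}\in R(\mathcal{A})$, $\mathcal{X}^{(0)}=\mathrm{prox}_{\lambda\mathrm{LSP}}(\mathcal{Z}^{(0)})$; for $k=0,1,2,\dots$ choose an index $i(k)\in\{1,\dots,n_1\}$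 and set $$\mathcal{Z}^{(k+1)}=\mathcal{Z}^{(k)}+t\,(\mathcal{A}(i(k)))^**_L\frac{\mathcal{B}(i(k))-\mathcal{A}(i(k))*_L\mathcal{X}^{(k)}}{\|\mathcal{A}(i(k))\|_F^2},\qquad \mathcal{X}^{(k+1)}=\mathrm{prox}_{\lambda\mathrm{LSP}}(\mathcal{Z}^{(k+1)}).$$ The iteration is run indefinitely (no stopping tolerance). The algorithm's parameters $\lambda,\varepsilon$ are chosen so that $(|z|+\varepsilon)^2\ge4\lambda$ for every entry $z$ of every tensor $\mathcal{Z}^{(k)}$ to which the prox is applied. *)

theory Defs
  imports
    "HOL-Probability.Probability"
    "Jordan_Normal_Form.Matrix"
    "Jordan_Normal_Form.Schur_Decomposition"
begin

text \<open>
  A tensor of order \<open>m\<close> and size \<open>ds = [n\<^sub>1, \<dots>, n\<^sub>m]\<close> is a function on multi-indices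
  (lists, with 0-based entries) that vanishes outside the index range, so that equality of tensors
  is equality of functions and differences are the pointwise differences of functions.
  Real tensors are the complex tensors with real entries.
\<close>

type_synonym tensor = "nat list \<Rightarrow> complex"

definition multi_indices :: "nat list \<Rightarrow> nat list set" where
  "multi_indices ds = {ix. length ix = length ds \<and> (\<forall>k<length ds. ix ! k < ds ! k)}"

definition tensors :: "nat list \<Rightarrow> tensor set" where
  "tensors ds = {X. \<forall>ix. ix \<notin> multi_indices ds \<longrightarrow> X ix = 0}"

definition real_tensors :: "nat list \<Rightarrow> tensor set" where
  "real_tensors ds = {X \<in> tensors ds. \<forall>ix. X ix \<in> \<real>}"

definition tensor_inner :: "nat list \<Rightarrow> tensor \<Rightarrow> tensor \<Rightarrow> complex" where
  "tensor_inner ds X Y = (\<Sum>ix\<in>multi_indices ds. X ix * cnj (Y ix))"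

definition fro_norm :: "nat list \<Rightarrow> tensor \<Rightarrow> real" where
  "fro_norm ds X = sqrt (\<Sum>ix\<in>multi_indices ds. (cmod (X ix))\<^sup>2)"

text \<open>
  Modes are numbered from 0.  For a tensor \<open>A\<close> whose mode \<open>k\<close> has dimension \<open>dim_col U\<close>, the
  mode-\<open>k\<close> unfolding of \<open>mode_prod k U A\<close> is \<open>U\<close> times the mode-\<open>k\<close> unfolding of \<open>A\<close>.
\<close>

definition mode_prod :: "nat \<Rightarrow> complex Matrix.mat \<Rightarrow> tensor \<Rightarrow> tensor" where
  "mode_prod k U A =
    (\<lambda>ix. if ix ! k < dim_row U then \<Sum>j<dim_col U. U $$ (ix ! k, j) * A (ix[k := j]) else 0)"

text \<open>
  In the following, \<open>Us = [U\<^bsub>n\<^sub>3\<^esub>, \<dots>, U\<^bsub>n\<^sub>m\<^esub>]\<close> and \<open>ns = [n\<^sub>3, \<dots>, n\<^sub>m]\<close>; the first two dimensions of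
  the tensors are passed separately.
\<close>

definition L_trans :: "complex Matrix.mat list \<Rightarrow> tensor \<Rightarrow> tensor" where
  "L_trans Us A = fold (\<lambda>i. mode_prod (i + 2) (Us ! i)) [0..<length Us] A"

definition L_inv :: "nat list \<Rightarrow> complex Matrix.mat list \<Rightarrow> nat \<Rightarrow> nat \<Rightarrow> tensor \<Rightarrow> tensor" where
  "L_inv ns Us p q = inv_into (tensors (p # q # ns)) (L_trans Us)"

definition frontal_slice :: "nat \<Rightarrow> nat \<Rightarrow> tensor \<Rightarrow> nat list \<Rightarrow> complex Matrix.mat" where
  "frontal_slice p q A js = Matrix.mat p q (\<lambda>(i, j). A (i # j # js))"

definition from_slices :: "nat \<Rightarrow> nat \<Rightarrow> nat list \<Rightarrow> (nat list \<Rightarrow> complex Matrix.mat) \<Rightarrow> tensor" where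
  "from_slices p q ns S =
    (\<lambda>ix. if ix \<in> multi_indices (p # q # ns) then S (drop 2 ix) $$ (ix ! 0, ix ! 1) else 0)"

definition facewise_prod :: "nat list \<Rightarrow> nat \<Rightarrow> nat \<Rightarrow> nat \<Rightarrow> tensor \<Rightarrow> tensor \<Rightarrow> tensor" where
  "facewise_prod ns p q r A B =
    from_slices p r ns (\<lambda>js. frontal_slice p q A js * frontal_slice q r B js)"

definition t_prod ::
  "nat list \<Rightarrow> complex Matrix.mat list \<Rightarrow> nat \<Rightarrow> nat \<Rightarrow> nat \<Rightarrow> tensor \<Rightarrow> tensor \<Rightarrow> tensor" where
  "t_prod ns Us p q r A B = L_inv ns Us p r (facewise_prod ns p q r (L_trans Us A) (L_trans Us B))"

text \<open>The argument has size \<open>p \<times> q \<times> ns\<close>, the result \<open>q \<times> p \<times> ns\<close>.\<close>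

definition conj_transpose ::
  "nat list \<Rightarrow> complex Matrix.mat list \<Rightarrow> nat \<Rightarrow> nat \<Rightarrow> tensor \<Rightarrow> tensor" where
  "conj_transpose ns Us p q A =
    L_inv ns Us q p (from_slices q p ns (\<lambda>js. mat_adjoint (frontal_slice p q (L_trans Us A) js)))"

definition kronecker :: "complex Matrix.mat \<Rightarrow> complex Matrix.mat \<Rightarrow> complex Matrix.mat" where
  "kronecker A B = Matrix.mat (dim_row A * dim_row B) (dim_col A * dim_col B)
    (\<lambda>(i, j). A $$ (i div dim_row B, j div dim_col B) * B $$ (i mod dim_row B, j mod dim_col B))"

text \<open>For \<open>[U\<^sub>3, \<dots>, U\<^sub>m]\<close> this is \<open>U\<^sub>m \<otimes> \<dots> \<otimes> U\<^sub>3\<close>.\<close>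

primrec kronecker_rev :: "complex Matrix.mat list \<Rightarrow> complex Matrix.mat" where
  "kronecker_rev [] = 1\<^sub>m 1"
| "kronecker_rev (U # Us) = kronecker (kronecker_rev Us) U"

definition admissible_transform :: "nat list \<Rightarrow> complex Matrix.mat list \<Rightarrow> real \<Rightarrow> bool" where
  "admissible_transform ns Us \<rho> \<longleftrightarrow>
    length Us = length ns \<and>
    (\<forall>i<length ns. Us ! i \<in> carrier_mat (ns ! i) (ns ! i) \<and> invertible_mat (Us ! i)) \<and>
    \<rho> > 0 \<and>
    kronecker_rev Us * mat_adjoint (kronecker_rev Us) = complex_of_real \<rho> \<cdot>\<^sub>m 1\<^sub>m (prod_list ns) \<and>
    mat_adjoint (kronecker_rev Us) * kronecker_rev Us = complex_of_real \<rho> \<cdot>\<^sub>m 1\<^sub>m (prod_list ns) \<and>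
    (\<forall>p q r. \<forall>A\<in>real_tensors (p # q # ns). \<forall>B\<in>real_tensors (q # r # ns).
      t_prod ns Us p q r A B \<in> real_tensors (p # r # ns))"

text \<open>The \<open>i\<close>-th horizontal slice, as a tensor whose first dimension is 1.\<close>

definition hslice :: "nat \<Rightarrow> tensor \<Rightarrow> tensor" where
  "hslice i A = (\<lambda>ix. case ix of [] \<Rightarrow> 0 | a # js \<Rightarrow> if a = 0 then A (i # js) else 0)"

definition row_space ::
  "nat list \<Rightarrow> complex Matrix.mat list \<Rightarrow> nat \<Rightarrow> nat \<Rightarrow> nat \<Rightarrow> tensor \<Rightarrow> tensor set" where
  "row_space ns Us n1 n2 l A =
    {t_prod ns Us n2 n1 l (conj_transpose ns Us n1 n2 A) Y | Y. Y \<in> real_tensors (n1 # l # ns)}"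

text \<open>
  Subgradients and Bregman distances are taken in the space of real tensors, where the inner product
  is real; \<open>Re\<close> only adjusts the type.
\<close>

definition subdifferential :: "nat list \<Rightarrow> (tensor \<Rightarrow> real) \<Rightarrow> tensor \<Rightarrow> tensor set" where
  "subdifferential ds f X =
    {Z \<in> real_tensors ds. \<forall>Y\<in>real_tensors ds. f Y \<ge> f X + Re (tensor_inner ds Z (Y - X))}"

definition bregman :: "nat list \<Rightarrow> (tensor \<Rightarrow> real) \<Rightarrow> tensor \<Rightarrow> tensor \<Rightarrow> tensor \<Rightarrow> real" where
  "bregman ds f Z X Y = f Y - f X - Re (tensor_inner ds Z (Y - X))"

definition LSP :: "nat list \<Rightarrow> real \<Rightarrow> tensor \<Rightarrow> real" where
  "LSP ds \<epsilon> X = (\<Sum>ix\<in>multi_indices ds. ln (1 + cmod (X ix) / \<epsilon>))"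

definition LSP_objective :: "nat list \<Rightarrow> real \<Rightarrow> real \<Rightarrow> tensor \<Rightarrow> real" where
  "LSP_objective ds lam \<epsilon> X =
    (\<Sum>ix\<in>multi_indices ds. lam * ln (1 + cmod (X ix) / \<epsilon>)) + 1/2 * (fro_norm ds X)\<^sup>2"

text \<open>The minimizer is unique if \<open>sqrt lam < \<epsilon>\<close>; otherwise \<open>arg_min\<close> selects some minimizer.\<close>

definition prox_LSP :: "nat list \<Rightarrow> real \<Rightarrow> real \<Rightarrow> tensor \<Rightarrow> tensor" where
  "prox_LSP ds lam \<epsilon> Z =
    arg_min (\<lambda>X. lam * LSP ds \<epsilon> X + 1/2 * (fro_norm ds (X - Z))\<^sup>2) (\<lambda>X. X \<in> real_tensors ds)"

definition kaczmarz_update ::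
  "nat list \<Rightarrow> complex Matrix.mat list \<Rightarrow> nat \<Rightarrow> nat \<Rightarrow> real \<Rightarrow> tensor \<Rightarrow> tensor \<Rightarrow> nat \<Rightarrow> tensor \<Rightarrow> tensor \<Rightarrow> tensor" where
  "kaczmarz_update ns Us n2 l t A B j Z X =
    (let R = hslice j B - t_prod ns Us 1 n2 l (hslice j A) X;
         S = (\<lambda>ix. R ix / complex_of_real ((fro_norm (1 # n2 # ns) (hslice j A))\<^sup>2));
         G = t_prod ns Us n2 1 l (conj_transpose ns Us 1 n2 (hslice j A)) S
     in (\<lambda>ix. Z ix + complex_of_real t * G ix))"

end

theory Submission
  imports Defs
begin

text \<open>
  The iteration is randomised mirror descent with the mirror map given by \<open>f\<close>, and two facts drive it.

  Geometry of the product.  The transform \<open>L\<close> acts on the last modes as multiplication by the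
  Kronecker product \<open>K\<close>, so \<open>K\<^sup>* K = K K\<^sup>* = \<rho> I\<close> makes \<open>L\<close> a bijection that multiplies inner products
  by \<open>\<rho>\<close> (\<open>L_trans_inner\<close>).  In the transformed domain the t-product is slice-wise matrix
  multiplication.  Hence the conjugate transpose is the adjoint of the t-product
  (\<open>t_prod_adjoint\<close>), and \<open>\<parallel>A * B\<parallel>\<^sup>2 \<le> \<rho> \<parallel>A\<parallel>\<^sup>2 \<parallel>B\<parallel>\<^sup>2\<close> (\<open>fro_norm_t_prod_le\<close>).

  Convexity of \<open>f\<close>.  The logarithmic penalty is concave in the modulus, but its curvature is at least
  \<open>- lam / \<epsilon>\<^sup>2\<close>, so \<open>f\<close> is strongly convex with modulus \<open>\<sigma> = 1 - lam / \<epsilon>\<^sup>2\<close>, which is positive when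
  \<open>sqrt lam < \<epsilon>\<close>.  The prox of \<open>Z\<close> minimises \<open>f - \<langle>Z, \<cdot>\<rangle>\<close>, so every iterate satisfies
  \<open>Z\<^sub>k \<in> \<partial>f(X\<^sub>k)\<close> (\<open>prox_LSP_subgradient\<close>).

  Write \<open>R\<^sub>j\<close> for the \<open>j\<close>-th slice of \<open>A * (X\<^sub>k - Xhat)\<close>.  Strong convexity bounds the change of the
  Bregman distance in a step by a linear term, which the adjoint property evaluates to
  \<open>- t \<parallel>R\<^sub>j\<parallel>\<^sup>2 / \<parallel>A(j)\<parallel>\<^sup>2\<close>, plus \<open>\<parallel>Z\<^sub>k\<^sub>+\<^sub>1 - Z\<^sub>k\<parallel>\<^sup>2 / (2 \<sigma>)\<close>, which the norm bound controls.  This gives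
  \<open>D\<^sub>k\<^sub>+\<^sub>1 \<le> D\<^sub>k - t (1 - t \<rho> / (2 \<sigma>)) \<parallel>R\<^sub>j\<parallel>\<^sup>2 / \<parallel>A(j)\<parallel>\<^sup>2\<close> on every path (\<open>kaczmarz_bregman_decrease\<close>).
  The distance therefore never exceeds its initial value and \<open>Z\<^sub>k\<close> stays in the row space, so the error
  bound with constant \<open>\<nu>\<close> applies to every iterate.  Averaging over \<open>j\<close> with probabilities
  \<open>\<parallel>A(j)\<parallel>\<^sup>2 / \<parallel>A\<parallel>\<^sup>2\<close> cancels the denominators, the slices add up to \<open>\<parallel>A * (X\<^sub>k - Xhat)\<parallel>\<^sup>2 \<ge> \<nu> D\<^sub>k\<close>, and the
  factor \<open>1 - q\<close> appears.  Strong convexity finally gives \<open>\<parallel>X\<^sub>k - Xhat\<parallel>\<^sup>2 \<le> 2 D\<^sub>k / \<sigma>\<close>.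

  Since each index takes only finitely many values, all expectations are finite sums over index
  sequences, and independence enters only as the product formula for their probabilities.
\<close>

section \<open>Multi-indices\<close>

lemma multi_indices_Nil: "multi_indices [] = {[]}"
  by (auto simp: multi_indices_def)

lemma Cons_mem_multi_indices:
  "j # js \<in> multi_indices (n # ns) \<longleftrightarrow> j < n \<and> js \<in> multi_indices ns"
  by (auto simp: multi_indices_def All_less_Suc2)

lemma multi_indices_Cons:
  "multi_indices (n # ns) = (\<lambda>(j, js). j # js) ` ({..<n} \<times> multi_indices ns)"
proof (intro equalityI subsetI)
  fix ix assume ix: "ix \<in> multi_indices (n # ns)"
  then obtain j js where "ix = j # js"
    by (cases ix) (auto simp: multi_indices_def)
  with ix show "ix \<in> (\<lambda>(j, js). j # js) ` ({..<n} \<times> multi_indices ns)"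
    by (auto simp: Cons_mem_multi_indices)
qed (auto simp: Cons_mem_multi_indices)

lemma finite_multi_indices: "finite (multi_indices ds)"
  by (induction ds) (simp_all add: multi_indices_Nil multi_indices_Cons)

lemma sum_multi_indices_Cons:
  "(\<Sum>ix\<in>multi_indices (n # ns). g ix) = (\<Sum>j<n. \<Sum>js\<in>multi_indices ns. g (j # js))"
proof -
  have "(\<Sum>ix\<in>multi_indices (n # ns). g ix) = (\<Sum>(j, js)\<in>{..<n} \<times> multi_indices ns. g (j # js))"
    unfolding multi_indices_Cons
    by (subst sum.reindex) (auto simp: inj_on_def intro!: sum.cong)
  then show ?thesis by (simp add: sum.cartesian_product)
qed

lemma multi_index2_cases:
  assumes "ix \<in> multi_indices (p # r # ns)"
  obtains i j js where "ix = i # j # js" "i < p" "j < r" "js \<in> multi_indices ns"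
  using assms by (auto simp: multi_indices_Cons)

section \<open>The transform as a scaled unitary map\<close>

text \<open>
  The entry of \<open>U\<^sub>m \<otimes> \<dots> \<otimes> U\<^sub>3\<close> at a pair of multi-indices: the Kronecker product of the mode
  matrices without the flattening of its indices (\<open>kronecker_rev_entry\<close>).
\<close>
fun mode_kernel :: "complex Matrix.mat list \<Rightarrow> nat list \<Rightarrow> nat list \<Rightarrow> complex" where
  "mode_kernel (U # Us) (j # js) (k # ks) = U $$ (j, k) * mode_kernel Us js ks"
| "mode_kernel _ _ _ = 1"

text \<open>Position of a multi-index in the vectorisation in which the first mode varies fastest.\<close>

fun flat_index :: "nat list \<Rightarrow> nat list \<Rightarrow> nat" where
  "flat_index (n # ns) (j # js) = flat_index ns js * n + j"
| "flat_index _ _ = 0"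

lemma bij_betw_flat_index: "bij_betw (flat_index ns) (multi_indices ns) {..<prod_list ns}"
proof (induction ns)
  case Nil
  then show ?case by (auto simp: multi_indices_Nil bij_betw_def)
next
  case (Cons n ns)
  have "bij_betw (\<lambda>(j, js). flat_index ns js * n + j) ({..<n} \<times> multi_indices ns) {..<n * prod_list ns}"
  proof (rule bij_betwI'[of _ _ _])
    fix x y assume x: "x \<in> {..<n} \<times> multi_indices ns" and y: "y \<in> {..<n} \<times> multi_indices ns"
    obtain j js k ks where [simp]: "x = (j, js)" "y = (k, ks)" by (metis surj_pair)
    from x y have lt: "j < n" "k < n" and m: "js \<in> multi_indices ns" "ks \<in> multi_indices ns" by auto
    show "((case x of (j, js) \<Rightarrow> flat_index ns js * n + j) = (case y of (j, js) \<Rightarrow> flat_index ns js * n + j)) = (x = y)"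
    proof
      assume "(case x of (j, js) \<Rightarrow> flat_index ns js * n + j) = (case y of (j, js) \<Rightarrow> flat_index ns js * n + j)"
      then have e: "flat_index ns js * n + j = flat_index ns ks * n + k" by simp
      from arg_cong[OF e, of "\<lambda>m. m mod n"] lt have "j = k" by simp
      with e lt have "flat_index ns js = flat_index ns ks" by simp
      with m Cons.IH have "js = ks" by (meson bij_betw_def inj_onD)
      with \<open>j = k\<close> show "x = y" by simp
    qed simp
  next
    fix x assume x: "x \<in> {..<n} \<times> multi_indices ns"
    obtain j js where [simp]: "x = (j, js)" by (metis surj_pair)
    from x Cons.IH have "flat_index ns js + 1 \<le> prod_list ns" and "j < n"
      by (auto dest: bij_betwE simp: Suc_le_eq)
    then have "flat_index ns js * n + j < (flat_index ns js + 1) * n" by simp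
    also have "\<dots> \<le> prod_list ns * n" using \<open>flat_index ns js + 1 \<le> prod_list ns\<close> by (rule mult_le_mono1)
    finally show "(case x of (j, js) \<Rightarrow> flat_index ns js * n + j) \<in> {..<n * prod_list ns}"
      by (simp add: mult.commute)
  next
    fix m assume "m \<in> {..<n * prod_list ns}"
    then have m: "m div n < prod_list ns" "m mod n < n"
      by (auto simp: less_mult_imp_div_less mult.commute intro!: mod_less_divisor gr0I)
    then have "m div n \<in> flat_index ns ` multi_indices ns"
      using Cons.IH by (simp add: bij_betw_imp_surj_on)
    then obtain js where "js \<in> multi_indices ns" "flat_index ns js = m div n" by auto
    with m show "\<exists>x\<in>{..<n} \<times> multi_indices ns. m = (case x of (j, js) \<Rightarrow> flat_index ns js * n + j)"
      by (intro bexI[of _ "(m mod n, js)"]) auto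
  qed
  moreover have "bij_betw (\<lambda>(j, js). j # js) ({..<n} \<times> multi_indices ns) (multi_indices (n # ns))"
    unfolding multi_indices_Cons by (intro bij_betw_imageI) (auto simp: inj_on_def)
  ultimately have "bij_betw (flat_index (n # ns) \<circ> (\<lambda>(j, js). j # js)) ({..<n} \<times> multi_indices ns) {..<n * prod_list ns}"
    by (simp add: comp_def case_prod_unfold)
  with \<open>bij_betw (\<lambda>(j, js). j # js) _ _\<close> show ?case
    by (simp add: bij_betw_comp_iff)
qed

lemma kronecker_rev_carrier:
  assumes "list_all2 (\<lambda>U n. U \<in> carrier_mat n n) Us ns"
  shows "kronecker_rev Us \<in> carrier_mat (prod_list ns) (prod_list ns)"
  using assms by (induction rule: list_all2_induct) (auto simp: kronecker_def mult.commute)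

lemma kronecker_rev_entry:
  assumes "list_all2 (\<lambda>U n. U \<in> carrier_mat n n) Us ns"
    and "js \<in> multi_indices ns" "ks \<in> multi_indices ns"
  shows "kronecker_rev Us $$ (flat_index ns js, flat_index ns ks) = mode_kernel Us js ks"
  using assms
proof (induction arbitrary: js ks rule: list_all2_induct)
  case Nil
  then show ?case by (simp add: multi_indices_Nil)
next
  case (Cons U Us n ns)
  obtain j js' k ks' where [simp]: "js = j # js'" "ks = k # ks'"
    and jk: "j < n" "k < n" "js' \<in> multi_indices ns" "ks' \<in> multi_indices ns"
    using Cons.prems by (auto simp: multi_indices_Cons)
  have K: "kronecker_rev Us \<in> carrier_mat (prod_list ns) (prod_list ns)"
    using Cons.hyps by (intro kronecker_rev_carrier)
  have lt: "flat_index (n # ns) is < prod_list ns * n" if "is \<in> multi_indices (n # ns)" for "is"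
    using bij_betwE[OF bij_betw_flat_index[of "n # ns"]] that by (auto simp: mult.commute)
  from lt[OF Cons.prems(1)] lt[OF Cons.prems(2)] jk Cons.hyps(1) K show ?case
    by (simp add: kronecker_def Cons.IH)
qed

text \<open>
  The modes are transformed one after the other, so the induction must speak of the modes behind an
  arbitrary prefix \<open>pre\<close> of untouched ones.
\<close>
lemma L_trans_aux_entry:
  assumes "list_all2 (\<lambda>U n. U \<in> carrier_mat n n) Us ns" "js \<in> multi_indices ns"
  shows "fold (\<lambda>i. mode_prod (i + length pre) (Us ! i)) [0..<length Us] A (pre @ js) =
    (\<Sum>ks\<in>multi_indices ns. mode_kernel Us js ks * A (pre @ ks))"
  using assms
proof (induction arbitrary: js pre A rule: list_all2_induct)
  case Nil
  then show ?case by (simp add: multi_indices_Nil)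
next
  case (Cons U Us n ns)
  obtain j js' where [simp]: "js = j # js'" and j: "j < n" "js' \<in> multi_indices ns"
    using Cons.prems by (auto simp: multi_indices_Cons)
  have U: "dim_row U = n" "dim_col U = n" using Cons.hyps by auto
  have "fold (\<lambda>i. mode_prod (i + length pre) ((U # Us) ! i)) [0..<length (U # Us)] A (pre @ js)
    = fold (\<lambda>i. mode_prod (i + length (pre @ [j])) (Us ! i)) [0..<length Us]
        (mode_prod (length pre) U A) ((pre @ [j]) @ js')"
  proof -
    have "[0..<length (U # Us)] = 0 # map Suc [0..<length Us]"
      by (simp add: upt_conv_Cons map_Suc_upt del: upt_Suc)
    then show ?thesis by (simp add: fold_map comp_def del: upt_Suc)
  qed
  also have "\<dots> = (\<Sum>ks\<in>multi_indices ns. mode_kernel Us js' ks * mode_prod (length pre) U A ((pre @ [j]) @ ks))"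
    using Cons.IH[OF j(2)] .
  also have "\<dots> = (\<Sum>ks\<in>multi_indices ns. \<Sum>k<n. U $$ (j, k) * mode_kernel Us js' ks * A (pre @ k # ks))"
    using j U by (simp add: mode_prod_def nth_append list_update_append sum_distrib_left ac_simps)
  also have "\<dots> = (\<Sum>k<n. \<Sum>ks\<in>multi_indices ns. U $$ (j, k) * mode_kernel Us js' ks * A (pre @ k # ks))"
    by (rule sum.swap)
  finally show ?case by (simp add: sum_multi_indices_Cons)
qed

lemma L_trans_entry:
  assumes "list_all2 (\<lambda>U n. U \<in> carrier_mat n n) Us ns" "js \<in> multi_indices ns"
  shows "L_trans Us A (i # j # js) = (\<Sum>ks\<in>multi_indices ns. mode_kernel Us js ks * A (i # j # ks))"
  using L_trans_aux_entry[OF assms, of "[i, j]" A] by (simp add: L_trans_def numeral_2_eq_2)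

text \<open>
  The sum in a mode product ignores the index of its own mode, but that index is tested against the row
  dimension; the other indices are passed on to \<open>A\<close>, so the zero pattern survives.
\<close>
lemma mode_prod_tensors:
  assumes A: "A \<in> tensors ds" and k: "k < length ds" and U: "U \<in> carrier_mat (ds ! k) (ds ! k)"
  shows "mode_prod k U A \<in> tensors ds"
  unfolding tensors_def
proof (intro CollectI allI impI)
  fix ix assume ix: "ix \<notin> multi_indices ds"
  show "mode_prod k U A ix = 0"
  proof (cases "ix ! k < ds ! k")
    case True
    have "ix[k := j] \<notin> multi_indices ds" for j
    proof
      assume a: "ix[k := j] \<in> multi_indices ds"
      have "ix ! m < ds ! m" if "m < length ds" for m
        using a that True by (cases "m = k") (auto simp: multi_indices_def nth_list_update dest: spec[of _ m])
      with a ix show False by (auto simp: multi_indices_def)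
    qed
    with A show ?thesis by (simp add: mode_prod_def tensors_def)
  qed (use U in \<open>simp add: mode_prod_def\<close>)
qed

lemma L_trans_tensors:
  assumes "list_all2 (\<lambda>U n. U \<in> carrier_mat n n) Us ns" and "A \<in> tensors (p # r # ns)"
  shows "L_trans Us A \<in> tensors (p # r # ns)"
proof -
  have "fold (\<lambda>i. mode_prod (i + 2) (Us ! i)) is A \<in> tensors (p # r # ns)"
    if "set is \<subseteq> {..<length Us}" "A \<in> tensors (p # r # ns)" for "is" A
    using that
  proof (induction "is" arbitrary: A)
    case (Cons i "is")
    then have i: "i < length Us" by simp
    then have "mode_prod (i + 2) (Us ! i) A \<in> tensors (p # r # ns)"
      using Cons.prems list_all2_lengthD[OF assms(1)] list_all2_nthD[OF assms(1) i]
      by (intro mode_prod_tensors) auto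
    with Cons show ?case by simp
  qed simp
  from this[OF _ assms(2), of "[0..<length Us]"] show ?thesis
    unfolding L_trans_def by (simp add: subset_iff)
qed

lemma tensor_eqI:
  assumes "C \<in> tensors (p # r # ns)" "D \<in> tensors (p # r # ns)"
    and "\<And>i j js. i < p \<Longrightarrow> j < r \<Longrightarrow> js \<in> multi_indices ns \<Longrightarrow> C (i # j # js) = D (i # j # js)"
  shows "C = D"
proof
  fix ix show "C ix = D ix"
    by (cases "ix \<in> multi_indices (p # r # ns)")
      (use assms in \<open>auto simp: tensors_def elim!: multi_index2_cases\<close>)
qed

locale scaled_unitary_transform =
  fixes ns :: "nat list" and Us :: "complex Matrix.mat list" and \<rho> :: real
  assumes admissible: "admissible_transform ns Us \<rho>"
begin

lemma rho_pos: "\<rho> > 0"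
  using admissible by (simp add: admissible_transform_def)

lemma Us_carrier: "list_all2 (\<lambda>U n. U \<in> carrier_mat n n) Us ns"
  using admissible by (simp add: admissible_transform_def list_all2_conv_all_nth)

text \<open>
  This lemma and the next are \<open>K K\<^sup>* = \<rho> I\<close> and \<open>K\<^sup>* K = \<rho> I\<close>, read entrywise over multi-indices.
\<close>
lemma kernel_orthogonal_rows:
  assumes "js \<in> multi_indices ns" "ks \<in> multi_indices ns"
  shows "(\<Sum>hs\<in>multi_indices ns. mode_kernel Us js hs * cnj (mode_kernel Us ks hs)) =
    (if js = ks then of_real \<rho> else 0)"
proof -
  let ?K = "kronecker_rev Us" and ?N = "prod_list ns" and ?e = "flat_index ns"
  have K: "?K \<in> carrier_mat ?N ?N" by (rule kronecker_rev_carrier[OF Us_carrier])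
  have lt: "?e js < ?N" "?e ks < ?N" using assms bij_betwE[OF bij_betw_flat_index[of ns]] by auto
  have "(if ?e js = ?e ks then of_real \<rho> else 0) = (of_real \<rho> \<cdot>\<^sub>m 1\<^sub>m ?N) $$ (?e js, ?e ks)"
    using lt by simp
  also have "\<dots> = (?K * mat_adjoint ?K) $$ (?e js, ?e ks)"
    using admissible by (simp add: admissible_transform_def)
  also have "\<dots> = (\<Sum>c<?N. ?K $$ (?e js, c) * cnj (?K $$ (?e ks, c)))"
    using K lt by (simp add: mat_adjoint_def scalar_prod_def mat_of_rows_def lessThan_atLeast0)
  also have "\<dots> = (\<Sum>hs\<in>multi_indices ns. ?K $$ (?e js, ?e hs) * cnj (?K $$ (?e ks, ?e hs)))"
    by (rule sum.reindex_bij_betw[OF bij_betw_flat_index, symmetric])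
  also have "\<dots> = (\<Sum>hs\<in>multi_indices ns. mode_kernel Us js hs * cnj (mode_kernel Us ks hs))"
    using assms by (simp add: kronecker_rev_entry[OF Us_carrier])
  finally show ?thesis
    using inj_on_eq_iff[OF bij_betw_imp_inj_on[OF bij_betw_flat_index[of ns]] assms] by simp
qed

lemma kernel_orthogonal_cols:
  assumes "js \<in> multi_indices ns" "ks \<in> multi_indices ns"
  shows "(\<Sum>hs\<in>multi_indices ns. cnj (mode_kernel Us hs js) * mode_kernel Us hs ks) =
    (if js = ks then of_real \<rho> else 0)"
proof -
  let ?K = "kronecker_rev Us" and ?N = "prod_list ns" and ?e = "flat_index ns"
  have K: "?K \<in> carrier_mat ?N ?N" by (rule kronecker_rev_carrier[OF Us_carrier])
  have lt: "?e js < ?N" "?e ks < ?N" using assms bij_betwE[OF bij_betw_flat_index[of ns]] by auto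
  have "(if ?e js = ?e ks then of_real \<rho> else 0) = (of_real \<rho> \<cdot>\<^sub>m 1\<^sub>m ?N) $$ (?e js, ?e ks)"
    using lt by simp
  also have "\<dots> = (mat_adjoint ?K * ?K) $$ (?e js, ?e ks)"
    using admissible by (simp add: admissible_transform_def)
  also have "\<dots> = (\<Sum>c<?N. cnj (?K $$ (c, ?e js)) * ?K $$ (c, ?e ks))"
    using K lt by (simp add: mat_adjoint_def scalar_prod_def mat_of_rows_def lessThan_atLeast0)
  also have "\<dots> = (\<Sum>hs\<in>multi_indices ns. cnj (?K $$ (?e hs, ?e js)) * ?K $$ (?e hs, ?e ks))"
    by (rule sum.reindex_bij_betw[OF bij_betw_flat_index, symmetric])
  also have "\<dots> = (\<Sum>hs\<in>multi_indices ns. cnj (mode_kernel Us hs js) * mode_kernel Us hs ks)"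
    using assms by (simp add: kronecker_rev_entry[OF Us_carrier])
  finally show ?thesis
    using inj_on_eq_iff[OF bij_betw_imp_inj_on[OF bij_betw_flat_index[of ns]] assms] by simp
qed

lemma mode_kernel_parseval:
  "(\<Sum>js\<in>multi_indices ns. (\<Sum>ks\<in>multi_indices ns. mode_kernel Us js ks * x ks)
      * cnj (\<Sum>hs\<in>multi_indices ns. mode_kernel Us js hs * y hs))
    = of_real \<rho> * (\<Sum>js\<in>multi_indices ns. x js * cnj (y js))" (is "?lhs = _")
proof -
  let ?I = "multi_indices ns" and ?k = "mode_kernel Us"
  have "?lhs = (\<Sum>js\<in>?I. \<Sum>ks\<in>?I. \<Sum>hs\<in>?I. (cnj (?k js hs) * ?k js ks) * (x ks * cnj (y hs)))"
    by (simp add: sum_product cnj_sum ac_simps)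
  also have "\<dots> = (\<Sum>ks\<in>?I. \<Sum>js\<in>?I. \<Sum>hs\<in>?I. (cnj (?k js hs) * ?k js ks) * (x ks * cnj (y hs)))"
    by (rule sum.swap)
  also have "\<dots> = (\<Sum>ks\<in>?I. \<Sum>hs\<in>?I. \<Sum>js\<in>?I. (cnj (?k js hs) * ?k js ks) * (x ks * cnj (y hs)))"
    by (intro sum.cong refl sum.swap)
  also have "\<dots> = (\<Sum>ks\<in>?I. \<Sum>hs\<in>?I. (\<Sum>js\<in>?I. cnj (?k js hs) * ?k js ks) * (x ks * cnj (y hs)))"
    by (simp add: sum_distrib_right)
  also have "\<dots> = (\<Sum>ks\<in>?I. \<Sum>hs\<in>?I. if hs = ks then of_real \<rho> * (x ks * cnj (y hs)) else 0)"
    by (intro sum.cong refl) (simp add: kernel_orthogonal_cols)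
  also have "\<dots> = (\<Sum>ks\<in>?I. of_real \<rho> * (x ks * cnj (y ks)))"
    by (simp add: finite_multi_indices)
  finally show ?thesis by (simp add: sum_distrib_left)
qed

lemma L_trans_inner:
  "tensor_inner (p # r # ns) (L_trans Us X) (L_trans Us Y) = of_real \<rho> * tensor_inner (p # r # ns) X Y"
  by (simp add: tensor_inner_def sum_multi_indices_Cons L_trans_entry[OF Us_carrier]
      mode_kernel_parseval sum_distrib_left[symmetric] del: cnj_sum complex_cnj_mult)

text \<open>
  Applying \<open>K\<^sup>*\<close> recovers a tensor from its transform up to the factor \<open>\<rho>\<close>, so identities between tensors
  may be checked on transforms.
\<close>
lemma L_trans_left_inverse:
  assumes "ks \<in> multi_indices ns"
  shows "(\<Sum>js\<in>multi_indices ns. cnj (mode_kernel Us js ks) * L_trans Us X (i # j # js)) =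
    of_real \<rho> * X (i # j # ks)"
proof -
  let ?I = "multi_indices ns" and ?k = "mode_kernel Us"
  have "(\<Sum>js\<in>?I. cnj (?k js ks) * L_trans Us X (i # j # js))
    = (\<Sum>js\<in>?I. \<Sum>hs\<in>?I. (cnj (?k js ks) * ?k js hs) * X (i # j # hs))"
    by (simp add: L_trans_entry[OF Us_carrier] sum_distrib_left ac_simps)
  also have "\<dots> = (\<Sum>hs\<in>?I. \<Sum>js\<in>?I. (cnj (?k js ks) * ?k js hs) * X (i # j # hs))"
    by (rule sum.swap)
  also have "\<dots> = (\<Sum>hs\<in>?I. (\<Sum>js\<in>?I. cnj (?k js ks) * ?k js hs) * X (i # j # hs))"
    by (simp add: sum_distrib_right)
  also have "\<dots> = (\<Sum>hs\<in>?I. if ks = hs then of_real \<rho> * X (i # j # hs) else 0)"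
    using assms by (intro sum.cong refl) (simp add: kernel_orthogonal_cols)
  finally show ?thesis using assms by (simp add: finite_multi_indices)
qed

text \<open>
  The way to prove that two t-products agree: after the transform both sides are explicit finite
  sums.
\<close>
lemma L_trans_eqD:
  assumes "X \<in> tensors (p # r # ns)" "Y \<in> tensors (p # r # ns)"
    and "\<And>i j js. i < p \<Longrightarrow> j < r \<Longrightarrow> js \<in> multi_indices ns \<Longrightarrow>
      L_trans Us X (i # j # js) = L_trans Us Y (i # j # js)"
  shows "X = Y"
proof (rule tensor_eqI[OF assms(1,2)])
  fix i j ks assume ij: "i < p" "j < r" and ks: "ks \<in> multi_indices ns"
  have "of_real \<rho> * X (i # j # ks) = of_real \<rho> * Y (i # j # ks)"
    unfolding L_trans_left_inverse[OF ks, symmetric] using ij by (intro sum.cong refl) (simp add: assms(3))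
  then show "X (i # j # ks) = Y (i # j # ks)" using rho_pos by simp
qed

lemma L_trans_surj:
  assumes Y: "Y \<in> tensors (p # r # ns)"
  shows "\<exists>X\<in>tensors (p # r # ns). L_trans Us X = Y"
proof
  let ?I = "multi_indices ns" and ?k = "mode_kernel Us"
  \<comment> \<open>The preimage is \<open>K\<^sup>* Y / \<rho>\<close>, applied along the last modes.\<close>
  define X where "X = (\<lambda>ix. if ix \<in> multi_indices (p # r # ns)
    then (\<Sum>hs\<in>?I. cnj (?k hs (drop 2 ix)) * Y (ix ! 0 # ix ! 1 # hs)) / of_real \<rho> else 0)"
  show X: "X \<in> tensors (p # r # ns)" by (simp add: X_def tensors_def)
  show "L_trans Us X = Y"
  proof (rule tensor_eqI[OF L_trans_tensors[OF Us_carrier X] Y])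
    fix i j js assume ij: "i < p" "j < r" and js: "js \<in> ?I"
    have "L_trans Us X (i # j # js)
      = (\<Sum>ks\<in>?I. \<Sum>hs\<in>?I. (?k js ks * cnj (?k hs ks)) * Y (i # j # hs) / of_real \<rho>)"
      using ij js by (simp add: L_trans_entry[OF Us_carrier] X_def Cons_mem_multi_indices
          sum_distrib_left sum_divide_distrib ac_simps)
    also have "\<dots> = (\<Sum>hs\<in>?I. \<Sum>ks\<in>?I. (?k js ks * cnj (?k hs ks)) * Y (i # j # hs) / of_real \<rho>)"
      by (rule sum.swap)
    also have "\<dots> = (\<Sum>hs\<in>?I. (\<Sum>ks\<in>?I. ?k js ks * cnj (?k hs ks)) * Y (i # j # hs) / of_real \<rho>)"
      by (simp add: sum_distrib_right sum_divide_distrib)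
    also have "\<dots> = (\<Sum>hs\<in>?I. if js = hs then Y (i # j # hs) else 0)"
      using js rho_pos by (intro sum.cong refl) (simp add: kernel_orthogonal_rows)
    finally show "L_trans Us X (i # j # js) = Y (i # j # js)"
      using js by (simp add: finite_multi_indices)
  qed
qed

lemma L_inv_tensors:
  assumes "Y \<in> tensors (p # r # ns)"
  shows "L_inv ns Us p r Y \<in> tensors (p # r # ns)"
proof -
  have "Y \<in> L_trans Us ` tensors (p # r # ns)" using L_trans_surj[OF assms] by auto
  then show ?thesis unfolding L_inv_def by (rule inv_into_into)
qed

lemma L_trans_L_inv:
  assumes "Y \<in> tensors (p # r # ns)"
  shows "L_trans Us (L_inv ns Us p r Y) = Y"
proof -
  have "Y \<in> L_trans Us ` tensors (p # r # ns)" using L_trans_surj[OF assms] by auto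
  then show ?thesis unfolding L_inv_def by (rule f_inv_into_f)
qed

lemma from_slices_tensors: "from_slices p r ns S \<in> tensors (p # r # ns)"
  by (simp add: from_slices_def tensors_def)

lemma t_prod_tensors: "t_prod ns Us p q r A B \<in> tensors (p # r # ns)"
  by (simp add: t_prod_def facewise_prod_def L_inv_tensors from_slices_tensors)

lemma conj_transpose_tensors: "conj_transpose ns Us p q A \<in> tensors (q # p # ns)"
  by (simp add: conj_transpose_def L_inv_tensors from_slices_tensors)

lemma L_trans_t_prod:
  assumes "i < p" "k < r" "js \<in> multi_indices ns"
  shows "L_trans Us (t_prod ns Us p q r A B) (i # k # js) =
    (\<Sum>j<q. L_trans Us A (i # j # js) * L_trans Us B (j # k # js))"
proof -
  have "L_trans Us (t_prod ns Us p q r A B) = facewise_prod ns p q r (L_trans Us A) (L_trans Us B)"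
    unfolding t_prod_def by (rule L_trans_L_inv) (simp add: facewise_prod_def from_slices_tensors)
  then show ?thesis
    using assms by (simp add: facewise_prod_def from_slices_def frontal_slice_def
        Cons_mem_multi_indices scalar_prod_def lessThan_atLeast0)
qed

lemma L_trans_conj_transpose:
  assumes "i < p" "j < q" "js \<in> multi_indices ns"
  shows "L_trans Us (conj_transpose ns Us p q A) (j # i # js) = cnj (L_trans Us A (i # j # js))"
proof -
  have "L_trans Us (conj_transpose ns Us p q A) =
    from_slices q p ns (\<lambda>js. mat_adjoint (frontal_slice p q (L_trans Us A) js))"
    unfolding conj_transpose_def by (rule L_trans_L_inv) (rule from_slices_tensors)
  then show ?thesis
    using assms by (simp add: from_slices_def frontal_slice_def Cons_mem_multi_indices
        mat_adjoint_def mat_of_rows_def)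
qed

lemma L_trans_affine:
  assumes "js \<in> multi_indices ns"
  shows "L_trans Us (\<lambda>ix. X ix + c * Y ix) (i # j # js) =
    L_trans Us X (i # j # js) + c * L_trans Us Y (i # j # js)"
  using assms by (simp add: L_trans_entry[OF Us_carrier] sum.distrib sum_distrib_left algebra_simps)

lemma t_prod_affine:
  "t_prod ns Us p q r A (\<lambda>ix. X ix + c * Y ix) =
    (\<lambda>ix. t_prod ns Us p q r A X ix + c * t_prod ns Us p q r A Y ix)"
proof (rule L_trans_eqD[OF t_prod_tensors])
  show "(\<lambda>ix. t_prod ns Us p q r A X ix + c * t_prod ns Us p q r A Y ix) \<in> tensors (p # r # ns)"
    using t_prod_tensors[of p q r A X] t_prod_tensors[of p q r A Y] by (simp add: tensors_def)
qed (simp add: L_trans_t_prod L_trans_affine sum.distrib sum_distrib_left algebra_simps)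

lemma t_prod_diff:
  "t_prod ns Us p q r A (X - Y) = t_prod ns Us p q r A X - t_prod ns Us p q r A Y"
  using t_prod_affine[of p q r A X "-1" Y] by (simp add: fun_diff_def)

text \<open>
  Slice-wise this is the adjoint property of matrices, and \<open>L\<close> preserves inner products up to the factor
  \<open>\<rho>\<close>, which cancels.
\<close>
lemma t_prod_adjoint:
  "tensor_inner (p # r # ns) (t_prod ns Us p q r A X) Y =
    tensor_inner (q # r # ns) X (t_prod ns Us q p r (conj_transpose ns Us p q A) Y)"
proof -
  let ?I = "multi_indices ns" and ?L = "L_trans Us"
  let ?term = "\<lambda>i j k js. ?L A (i # j # js) * ?L X (j # k # js) * cnj (?L Y (i # k # js))"
  have "of_real \<rho> * tensor_inner (p # r # ns) (t_prod ns Us p q r A X) Y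
    = (\<Sum>i<p. \<Sum>k<r. \<Sum>js\<in>?I. \<Sum>j<q. ?term i j k js)"
    unfolding L_trans_inner[symmetric]
    by (simp add: tensor_inner_def sum_multi_indices_Cons L_trans_t_prod sum_distrib_right)
  \<comment> \<open>The summation order is moved from \<open>(i, k, js, j)\<close> to \<open>(j, k, js, i)\<close>.\<close>
  also have "\<dots> = (\<Sum>i<p. \<Sum>k<r. \<Sum>j<q. \<Sum>js\<in>?I. ?term i j k js)"
    by (intro sum.cong refl sum.swap)
  also have "\<dots> = (\<Sum>i<p. \<Sum>j<q. \<Sum>k<r. \<Sum>js\<in>?I. ?term i j k js)"
    by (intro sum.cong refl sum.swap)
  also have "\<dots> = (\<Sum>j<q. \<Sum>i<p. \<Sum>k<r. \<Sum>js\<in>?I. ?term i j k js)"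
    by (rule sum.swap)
  also have "\<dots> = (\<Sum>j<q. \<Sum>k<r. \<Sum>i<p. \<Sum>js\<in>?I. ?term i j k js)"
    by (intro sum.cong refl sum.swap)
  also have "\<dots> = (\<Sum>j<q. \<Sum>k<r. \<Sum>js\<in>?I. \<Sum>i<p. ?term i j k js)"
    by (intro sum.cong refl sum.swap)
  also have "\<dots> = of_real \<rho> * tensor_inner (q # r # ns) X (t_prod ns Us q p r (conj_transpose ns Us p q A) Y)"
    unfolding L_trans_inner[symmetric]
    by (simp add: tensor_inner_def sum_multi_indices_Cons L_trans_t_prod L_trans_conj_transpose
        sum_distrib_left cnj_sum ac_simps)
  finally show ?thesis using rho_pos by simp
qed

text \<open>
  Admissibility speaks of t-products of real tensors; realness passes to the adjoint by duality: the
  inner products of \<open>A\<^sup>* * Y\<close> with real unit tensors \<open>E\<close> equal inner products of the real tensors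
  \<open>A * E\<close> and \<open>Y\<close>, and they are the conjugated entries of \<open>A\<^sup>* * Y\<close>.
\<close>
lemma conj_transpose_t_prod_real:
  assumes A: "A \<in> real_tensors (p # q # ns)" and Y: "Y \<in> real_tensors (p # r # ns)"
  shows "t_prod ns Us q p r (conj_transpose ns Us p q A) Y \<in> real_tensors (q # r # ns)"
proof -
  let ?W = "t_prod ns Us q p r (conj_transpose ns Us p q A) Y"
  have "?W ix \<in> \<real>" for ix
  proof (cases "ix \<in> multi_indices (q # r # ns)")
    case True
    define E :: tensor where "E = (\<lambda>kx. if ix = kx then 1 else 0)"
    have "E \<in> real_tensors (q # r # ns)" using True by (auto simp: E_def real_tensors_def tensors_def)
    then have AE: "t_prod ns Us p q r A E \<in> real_tensors (p # r # ns)"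
      using A admissible by (auto simp: admissible_transform_def)
    have "cnj (?W ix) = tensor_inner (q # r # ns) E ?W"
      using True by (simp add: tensor_inner_def E_def if_distrib[where f="\<lambda>x. x * _"]
          finite_multi_indices cong: if_cong)
    also have "\<dots> = tensor_inner (p # r # ns) (t_prod ns Us p q r A E) Y"
      by (rule t_prod_adjoint[symmetric])
    also have "\<dots> \<in> \<real>"
      using AE Y by (auto simp: tensor_inner_def real_tensors_def Reals_cnj_iff intro!: sum_in_Reals Reals_mult)
    finally show ?thesis by (metis Reals_cnj_iff complex_cnj_cnj)
  qed (use t_prod_tensors[of q p r] in \<open>simp add: tensors_def\<close>)
  then show ?thesis using t_prod_tensors by (simp add: real_tensors_def)
qed

end

lemma fro_norm_sq: "(fro_norm ds X)\<^sup>2 = (\<Sum>ix\<in>multi_indices ds. (cmod (X ix))\<^sup>2)"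
  by (simp add: fro_norm_def sum_nonneg)

lemma fro_norm_sq_inner: "(fro_norm ds X)\<^sup>2 = Re (tensor_inner ds X X)"
  by (simp add: fro_norm_sq tensor_inner_def Re_sum complex_mult_cnj cmod_power2)

lemma norm_sum_mult_sq_le:
  fixes a b :: "'i \<Rightarrow> complex"
  shows "(cmod (\<Sum>j\<in>J. a j * b j))\<^sup>2 \<le> (\<Sum>j\<in>J. (cmod (a j))\<^sup>2) * (\<Sum>j\<in>J. (cmod (b j))\<^sup>2)"
proof -
  have "cmod (\<Sum>j\<in>J. a j * b j) \<le> (\<Sum>j\<in>J. cmod (a j) * cmod (b j))"
    by (rule order_trans[OF norm_sum]) (simp add: norm_mult)
  then have "(cmod (\<Sum>j\<in>J. a j * b j))\<^sup>2 \<le> (\<Sum>j\<in>J. cmod (a j) * cmod (b j))\<^sup>2"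
    by (intro power_mono) auto
  also have "\<dots> \<le> (\<Sum>j\<in>J. (cmod (a j))\<^sup>2) * (\<Sum>j\<in>J. (cmod (b j))\<^sup>2)"
    by (rule Cauchy_Schwarz_ineq_sum)
  finally show ?thesis .
qed

lemma sum_mult_le_mult_sum:
  fixes a b :: "'i \<Rightarrow> real"
  assumes "finite I" "\<And>i. i \<in> I \<Longrightarrow> 0 \<le> a i" "\<And>i. i \<in> I \<Longrightarrow> 0 \<le> b i"
  shows "(\<Sum>i\<in>I. a i * b i) \<le> (\<Sum>i\<in>I. a i) * (\<Sum>i\<in>I. b i)"
proof -
  have "(\<Sum>i\<in>I. a i * b i) \<le> (\<Sum>i\<in>I. a i * (\<Sum>i\<in>I. b i))"
    using assms by (intro sum_mono mult_left_mono member_le_sum) auto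
  then show ?thesis by (simp add: sum_distrib_right)
qed

context scaled_unitary_transform
begin

lemma fro_norm_L_trans: "(fro_norm (p # r # ns) (L_trans Us X))\<^sup>2 = \<rho> * (fro_norm (p # r # ns) X)\<^sup>2"
  by (simp add: fro_norm_sq_inner L_trans_inner)

text \<open>
  Slice-wise the Frobenius norm is submultiplicative, and a sum of products is at most the product of
  the sums.  The transformed norms contribute \<open>\<rho>\<close> on the left and \<open>\<rho>\<^sup>2\<close> on the right.
\<close>
lemma fro_norm_t_prod_le:
  "(fro_norm (p # r # ns) (t_prod ns Us p q r A B))\<^sup>2
    \<le> \<rho> * (fro_norm (p # q # ns) A)\<^sup>2 * (fro_norm (q # r # ns) B)\<^sup>2"
proof -
  let ?I = "multi_indices ns" and ?L = "L_trans Us"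
  define a where "a = (\<lambda>js. \<Sum>i<p. \<Sum>j<q. (cmod (?L A (i # j # js)))\<^sup>2)"
  define b where "b = (\<lambda>js. \<Sum>k<r. \<Sum>j<q. (cmod (?L B (j # k # js)))\<^sup>2)"
  have reorder: "(fro_norm (p # r # ns) (?L C))\<^sup>2 = (\<Sum>js\<in>?I. \<Sum>i<p. \<Sum>k<r. (cmod (?L C (i # k # js)))\<^sup>2)"
    for p r C
  proof -
    have "(fro_norm (p # r # ns) (?L C))\<^sup>2 = (\<Sum>i<p. \<Sum>k<r. \<Sum>js\<in>?I. (cmod (?L C (i # k # js)))\<^sup>2)"
      by (simp add: fro_norm_sq sum_multi_indices_Cons)
    also have "\<dots> = (\<Sum>i<p. \<Sum>js\<in>?I. \<Sum>k<r. (cmod (?L C (i # k # js)))\<^sup>2)"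
      by (intro sum.cong refl sum.swap)
    finally show ?thesis by (subst (asm) sum.swap)
  qed
  have "\<rho> * (fro_norm (p # r # ns) (t_prod ns Us p q r A B))\<^sup>2
    = (\<Sum>js\<in>?I. \<Sum>i<p. \<Sum>k<r. (cmod (\<Sum>j<q. ?L A (i # j # js) * ?L B (j # k # js)))\<^sup>2)"
    unfolding fro_norm_L_trans[symmetric] reorder by (simp add: L_trans_t_prod)
  also have "\<dots> \<le> (\<Sum>js\<in>?I. \<Sum>i<p. \<Sum>k<r.
      (\<Sum>j<q. (cmod (?L A (i # j # js)))\<^sup>2) * (\<Sum>j<q. (cmod (?L B (j # k # js)))\<^sup>2))"
    by (intro sum_mono norm_sum_mult_sq_le)
  also have "\<dots> = (\<Sum>js\<in>?I. a js * b js)"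
    by (simp add: a_def b_def sum_product)
  also have "\<dots> \<le> (\<Sum>js\<in>?I. a js) * (\<Sum>js\<in>?I. b js)"
    by (intro sum_mult_le_mult_sum finite_multi_indices) (simp_all add: a_def b_def sum_nonneg)
  also have "(\<Sum>js\<in>?I. a js) = \<rho> * (fro_norm (p # q # ns) A)\<^sup>2"
    unfolding fro_norm_L_trans[symmetric] reorder a_def ..
  also have "(\<Sum>js\<in>?I. b js) = \<rho> * (fro_norm (q # r # ns) B)\<^sup>2"
    unfolding fro_norm_L_trans[symmetric] reorder b_def by (intro sum.cong refl sum.swap)
  finally show ?thesis using rho_pos by (simp add: mult.assoc mult.left_commute)
qed

lemma fro_norm_conj_transpose:
  "(fro_norm (q # p # ns) (conj_transpose ns Us p q A))\<^sup>2 = (fro_norm (p # q # ns) A)\<^sup>2"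
proof -
  have "\<rho> * (fro_norm (q # p # ns) (conj_transpose ns Us p q A))\<^sup>2
    = (\<Sum>j<q. \<Sum>i<p. \<Sum>js\<in>multi_indices ns. (cmod (L_trans Us A (i # j # js)))\<^sup>2)"
    unfolding fro_norm_L_trans[symmetric]
    by (simp add: fro_norm_sq sum_multi_indices_Cons L_trans_conj_transpose)
  also have "\<dots> = \<rho> * (fro_norm (p # q # ns) A)\<^sup>2"
    unfolding fro_norm_L_trans[symmetric]
    unfolding fro_norm_sq sum_multi_indices_Cons by (rule sum.swap)
  finally show ?thesis using rho_pos by simp
qed

end

section \<open>Horizontal slices\<close>

text \<open>
  The adjoint of \<open>hslice i\<close>.
\<close>
definition row_embedding :: "nat \<Rightarrow> tensor \<Rightarrow> tensor" where
  "row_embedding i S = (\<lambda>ix. case ix of [] \<Rightarrow> 0 | a # js \<Rightarrow> if a = i then S (0 # js) else 0)"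

lemma hslice_Cons: "hslice i A (0 # js) = A (i # js)"
  by (simp add: hslice_def)

lemma hslice_tensors:
  assumes "A \<in> tensors (p # ds)" shows "hslice i A \<in> tensors (1 # ds)"
  using assms by (auto simp: tensors_def hslice_def Cons_mem_multi_indices split: list.split)

lemma hslice_real_tensors:
  assumes "A \<in> real_tensors (p # ds)" shows "hslice i A \<in> real_tensors (1 # ds)"
  using assms hslice_tensors[of A p ds i] by (auto simp: real_tensors_def hslice_def split: list.split)

lemma hslice_diff: "hslice i (A - B) = hslice i A - hslice i B"
  by (auto simp: hslice_def split: list.split)

lemma row_embedding_real_tensors:
  assumes "S \<in> real_tensors (1 # ds)" "i < p" shows "row_embedding i S \<in> real_tensors (p # ds)"
  using assms
  by (auto simp: real_tensors_def tensors_def row_embedding_def Cons_mem_multi_indices split: list.split)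

lemma fro_norm_hslice_sum:
  "(\<Sum>i<p. (fro_norm (1 # ds) (hslice i A))\<^sup>2) = (fro_norm (p # ds) A)\<^sup>2"
  by (simp add: fro_norm_sq sum_multi_indices_Cons hslice_Cons)

lemma fro_norm_eq_0:
  assumes "A \<in> tensors ds" "fro_norm ds A = 0" shows "A = (\<lambda>_. 0)"
proof
  fix ix
  have "(\<Sum>ix\<in>multi_indices ds. (cmod (A ix))\<^sup>2) = 0" using assms(2) by (simp add: fro_norm_def)
  then show "A ix = 0"
    using assms(1) by (cases "ix \<in> multi_indices ds")
      (auto simp: sum_nonneg_eq_0_iff finite_multi_indices tensors_def)
qed

context scaled_unitary_transform
begin

lemma L_trans_hslice:
  assumes "js \<in> multi_indices ns"
  shows "L_trans Us (hslice i A) (0 # j # js) = L_trans Us A (i # j # js)"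
  using assms by (simp add: L_trans_entry[OF Us_carrier] hslice_Cons)

lemma L_trans_row_embedding:
  assumes "js \<in> multi_indices ns"
  shows "L_trans Us (row_embedding i S) (a # j # js) = (if a = i then L_trans Us S (0 # j # js) else 0)"
  using assms by (simp add: L_trans_entry[OF Us_carrier] row_embedding_def)

lemma hslice_t_prod:
  assumes "i < p"
  shows "t_prod ns Us 1 q r (hslice i A) X = hslice i (t_prod ns Us p q r A X)"
  by (rule L_trans_eqD[OF t_prod_tensors hslice_tensors[OF t_prod_tensors]])
    (use assms in \<open>simp add: L_trans_t_prod L_trans_hslice\<close>)

text \<open>
  An update direction built from a single slice of \<open>A\<close> is thereby seen to lie in the row space of
  \<open>A\<close>.
\<close>
lemma conj_transpose_hslice_t_prod:
  assumes "i < p"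
  shows "t_prod ns Us q 1 r (conj_transpose ns Us 1 q (hslice i A)) S =
    t_prod ns Us q p r (conj_transpose ns Us p q A) (row_embedding i S)"
proof (rule L_trans_eqD[OF t_prod_tensors t_prod_tensors])
  fix j k js assume "j < q" "k < r" "js \<in> multi_indices ns"
  then show "L_trans Us (t_prod ns Us q 1 r (conj_transpose ns Us 1 q (hslice i A)) S) (j # k # js) =
    L_trans Us (t_prod ns Us q p r (conj_transpose ns Us p q A) (row_embedding i S)) (j # k # js)"
    using assms by (simp add: L_trans_t_prod L_trans_conj_transpose L_trans_hslice
        L_trans_row_embedding if_distrib[where f="\<lambda>x. _ * x"] cong: if_cong)
qed

end

section \<open>Strong convexity of the penalty and its proximal map\<close>

lemma tensor_inner_diff_left: "tensor_inner ds (X - Y) W = tensor_inner ds X W - tensor_inner ds Y W"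
  by (simp add: tensor_inner_def algebra_simps sum_subtractf)

lemma tensor_inner_diff_right: "tensor_inner ds W (X - Y) = tensor_inner ds W X - tensor_inner ds W Y"
  by (simp add: tensor_inner_def algebra_simps sum_subtractf)

lemma Re_tensor_inner_commute: "Re (tensor_inner ds X Y) = Re (tensor_inner ds Y X)"
  by (simp add: tensor_inner_def Re_sum ac_simps)

lemma real_tensors_diff:
  "X \<in> real_tensors ds \<Longrightarrow> Y \<in> real_tensors ds \<Longrightarrow> X - Y \<in> real_tensors ds"
  by (auto simp: real_tensors_def tensors_def)

lemma norm_convex_comb_sq:
  "(cmod (of_real (1 - s) * x + of_real s * y))\<^sup>2 =
    (1 - s) * (cmod x)\<^sup>2 + s * (cmod y)\<^sup>2 - s * (1 - s) * (cmod (x - y))\<^sup>2"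
  unfolding cmod_power2 by (simp add: algebra_simps power2_eq_square)

text \<open>
  The second derivative of the logarithm is \<open>- 1 / (\<epsilon> + x)\<^sup>2 \<ge> - 1 / \<epsilon>\<^sup>2\<close>, so adding half of
  \<open>x\<^sup>2 / \<epsilon>\<^sup>2\<close> makes the sum convex.
\<close>
lemma convex_log_plus_square:
  assumes "\<epsilon> > 0"
  shows "convex_on {0..} (\<lambda>x::real. ln (1 + x / \<epsilon>) + x\<^sup>2 / (2 * \<epsilon>\<^sup>2))"
proof (rule f''_ge0_imp_convex)
  fix x :: real assume x: "x \<in> {0..}"
  then have p: "\<epsilon> + x > 0" "1 + x / \<epsilon> > 0" using assms by (auto intro: add_pos_nonneg)
  show "((\<lambda>x. ln (1 + x / \<epsilon>) + x\<^sup>2 / (2 * \<epsilon>\<^sup>2)) has_real_derivative 1 / (\<epsilon> + x) + x / \<epsilon>\<^sup>2) (at x)"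
  proof -
    have "((\<lambda>x. ln (1 + x / \<epsilon>) + x\<^sup>2 / (2 * \<epsilon>\<^sup>2)) has_real_derivative
        (1 / \<epsilon>) / (1 + x / \<epsilon>) + 2 * x / (2 * \<epsilon>\<^sup>2)) (at x)"
      using p assms by (auto intro!: derivative_eq_intros simp: power2_eq_square power4_eq_xxxx)
    moreover have "(1 / \<epsilon>) / (1 + x / \<epsilon>) = 1 / (\<epsilon> + x)"
      using assms p by (simp add: field_simps)
    ultimately show ?thesis by simp
  qed
  show "((\<lambda>x. 1 / (\<epsilon> + x) + x / \<epsilon>\<^sup>2) has_real_derivative 1 / \<epsilon>\<^sup>2 - 1 / (\<epsilon> + x)\<^sup>2) (at x)"
    using assms p by (auto intro!: derivative_eq_intros simp: power2_eq_square)
  have "\<epsilon>\<^sup>2 \<le> (\<epsilon> + x)\<^sup>2" using assms x by (intro power_mono) auto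
  then show "0 \<le> 1 / \<epsilon>\<^sup>2 - 1 / (\<epsilon> + x)\<^sup>2"
    using assms by (simp add: frac_le)
qed (rule convex_real_interval)

text \<open>
  Half of \<open>lam / \<epsilon>\<^sup>2\<close> times the square is used up to make the logarithm convex; what remains of the
  square provides the modulus.  Passing from moduli to complex entries uses
  the triangle inequality and that the convexified penalty is nondecreasing in the modulus.
\<close>
lemma log_penalty_strongly_convex:
  fixes x y :: complex
  assumes lam: "lam > 0" and eps: "\<epsilon> > 0" and s: "0 \<le> s" "s \<le> 1"
  defines "h \<equiv> \<lambda>z. lam * ln (1 + cmod z / \<epsilon>) + 1/2 * (cmod z)\<^sup>2"
  shows "h (of_real (1 - s) * x + of_real s * y) \<le>
    (1 - s) * h x + s * h y - (1 - lam / \<epsilon>\<^sup>2) / 2 * (s * (1 - s) * (cmod (x - y))\<^sup>2)"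
proof -
  define \<phi> :: "real \<Rightarrow> real" where "\<phi> = (\<lambda>x. ln (1 + x / \<epsilon>) + x\<^sup>2 / (2 * \<epsilon>\<^sup>2))"
  define w where "w = of_real (1 - s) * x + of_real s * y"
  define c where "c = (1 - lam / \<epsilon>\<^sup>2) / 2"
  have h: "h z = lam * \<phi> (cmod z) + c * (cmod z)\<^sup>2" for z
    using eps by (simp add: h_def \<phi>_def c_def field_simps)
  have mono: "\<phi> u \<le> \<phi> v" if "0 \<le> u" "u \<le> v" for u v
  proof -
    have "ln (1 + u / \<epsilon>) \<le> ln (1 + v / \<epsilon>)"
      using that eps by (subst ln_le_cancel_iff) (auto intro: add_pos_nonneg divide_right_mono)
    moreover have "u\<^sup>2 / (2 * \<epsilon>\<^sup>2) \<le> v\<^sup>2 / (2 * \<epsilon>\<^sup>2)"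
      using that by (intro divide_right_mono power_mono) auto
    ultimately show ?thesis by (simp add: \<phi>_def)
  qed
  have "cmod w \<le> (1 - s) * cmod x + s * cmod y"
    unfolding w_def using s
    by (intro order_trans[OF norm_triangle_ineq]) (simp add: norm_mult del: of_real_diff)
  then have "\<phi> (cmod w) \<le> \<phi> ((1 - s) * cmod x + s * cmod y)"
    by (intro mono) auto
  also have "\<dots> \<le> (1 - s) * \<phi> (cmod x) + s * \<phi> (cmod y)"
    using convex_onD[OF convex_log_plus_square[OF eps] s, of "cmod x" "cmod y"] by (simp add: \<phi>_def)
  finally have "lam * \<phi> (cmod w) \<le> lam * ((1 - s) * \<phi> (cmod x) + s * \<phi> (cmod y))"
    using lam by simp
  moreover have "c * (cmod w)\<^sup>2 =
      c * ((1 - s) * (cmod x)\<^sup>2 + s * (cmod y)\<^sup>2 - s * (1 - s) * (cmod (x - y))\<^sup>2)"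
    unfolding w_def norm_convex_comb_sq ..
  ultimately show ?thesis
    unfolding w_def[symmetric] c_def[symmetric] h by (simp add: algebra_simps)
qed

lemma LSP_objective_sum:
  "LSP_objective ds lam \<epsilon> X =
    (\<Sum>ix\<in>multi_indices ds. lam * ln (1 + cmod (X ix) / \<epsilon>) + 1/2 * (cmod (X ix))\<^sup>2)"
  by (simp add: LSP_objective_def fro_norm_sq sum.distrib sum_distrib_left sum_divide_distrib)

lemma LSP_objective_strongly_convex:
  assumes "lam > 0" "\<epsilon> > 0" "0 \<le> s" "s \<le> 1"
  shows "LSP_objective ds lam \<epsilon> (\<lambda>ix. of_real (1 - s) * X ix + of_real s * Y ix) \<le>
    (1 - s) * LSP_objective ds lam \<epsilon> X + s * LSP_objective ds lam \<epsilon> Y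
      - (1 - lam / \<epsilon>\<^sup>2) / 2 * (s * (1 - s) * (fro_norm ds (X - Y))\<^sup>2)"
  unfolding LSP_objective_sum fro_norm_sq sum_distrib_left sum.distrib[symmetric] sum_subtractf[symmetric]
  using log_penalty_strongly_convex[OF assms] by (intro sum_mono) simp

text \<open>
  Comparing the subgradient inequality with strong convexity at the point \<open>(1 - s) X + s Y\<close> and dividing
  by \<open>s\<close> gives the bound with an extra factor \<open>1 - s\<close>, which tends to 1 as \<open>s\<close> tends to 0.
\<close>
lemma bregman_LSP_lower_bound:
  assumes lam: "lam > 0" and eps: "\<epsilon> > 0"
    and X: "X \<in> real_tensors ds" and Y: "Y \<in> real_tensors ds"
    and Z: "Z \<in> subdifferential ds (LSP_objective ds lam \<epsilon>) X"
  shows "(1 - lam / \<epsilon>\<^sup>2) / 2 * (fro_norm ds (X - Y))\<^sup>2 \<le> bregman ds (LSP_objective ds lam \<epsilon>) Z X Y"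
proof (rule field_le_mult_one_interval)
  let ?f = "LSP_objective ds lam \<epsilon>" and ?c = "(1 - lam / \<epsilon>\<^sup>2) / 2 * (fro_norm ds (X - Y))\<^sup>2"
  fix r :: real assume r: "0 < r" "r < 1"
  define s where "s = 1 - r"
  define W where "W = (\<lambda>ix. of_real (1 - s) * X ix + of_real s * Y ix)"
  have W: "W \<in> real_tensors ds"
    using X Y by (auto simp: W_def real_tensors_def tensors_def)
  have "W - X = (\<lambda>ix. of_real s * (Y - X) ix)"
    by (auto simp: W_def algebra_simps)
  then have "tensor_inner ds Z (W - X) = of_real s * tensor_inner ds Z (Y - X)"
    by (simp add: tensor_inner_def sum_distrib_left ac_simps)
  then have "?f X + s * Re (tensor_inner ds Z (Y - X)) \<le> ?f W"
    using Z W by (auto simp: subdifferential_def)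
  also have "\<dots> \<le> (1 - s) * ?f X + s * ?f Y - s * (1 - s) * ?c"
    using LSP_objective_strongly_convex[OF lam eps, of s ds X Y] r by (simp add: W_def s_def ac_simps)
  finally have "s * ((1 - s) * ?c) \<le> s * bregman ds ?f Z X Y"
    by (simp add: bregman_def algebra_simps)
  then show "r * ?c \<le> bregman ds ?f Z X Y"
    using r by (simp add: s_def)
qed

text \<open>
  Expand \<open>0 \<le> \<bar>\<sigma> e - d\<bar>\<^sup>2\<close> in every entry.
\<close>
lemma young_tensor_inner:
  assumes "\<sigma> > 0"
  shows "Re (tensor_inner ds D E) \<le> \<sigma> / 2 * (fro_norm ds E)\<^sup>2 + 1 / (2 * \<sigma>) * (fro_norm ds D)\<^sup>2"
proof -
  have "Re (d * cnj e) \<le> \<sigma> / 2 * (cmod e)\<^sup>2 + 1 / (2 * \<sigma>) * (cmod d)\<^sup>2" for d e :: complex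
  proof -
    have "0 \<le> (cmod (of_real \<sigma> * e - d))\<^sup>2" by simp
    also have "\<dots> = \<sigma>\<^sup>2 * (cmod e)\<^sup>2 + (cmod d)\<^sup>2 - 2 * \<sigma> * Re (d * cnj e)"
      unfolding cmod_power2 by (simp add: power2_eq_square algebra_simps)
    finally show ?thesis using assms by (simp add: field_simps power2_eq_square)
  qed
  then show ?thesis
    unfolding tensor_inner_def fro_norm_sq Re_sum sum_distrib_left sum.distrib[symmetric]
    by (intro sum_mono)
qed

text \<open>
  The three-point identity
  \<open>D' = D + \<langle>Z' - Z, X - Y\<rangle> + \<langle>Z' - Z, X' - X\<rangle> - D\<^bsub>f,Z\<^esub>(X, X')\<close>: the unknown displacement \<open>X' - X\<close> is
  absorbed by the strong convexity of the last term.  This plays the role of Lipschitz continuity of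
  the gradient of the convex conjugate.
\<close>
lemma bregman_LSP_step:
  assumes lam: "lam > 0" and eps: "\<epsilon> > 0" and \<sigma>: "\<sigma> = 1 - lam / \<epsilon>\<^sup>2" "\<sigma> > 0"
    and X: "X \<in> real_tensors ds" and X': "X' \<in> real_tensors ds"
    and Z: "Z \<in> subdifferential ds (LSP_objective ds lam \<epsilon>) X"
  shows "bregman ds (LSP_objective ds lam \<epsilon>) Z' X' Y \<le>
    bregman ds (LSP_objective ds lam \<epsilon>) Z X Y + Re (tensor_inner ds (Z' - Z) (X - Y))
      + 1 / (2 * \<sigma>) * (fro_norm ds (Z' - Z))\<^sup>2"
proof -
  let ?f = "LSP_objective ds lam \<epsilon>"
  have "bregman ds ?f Z' X' Y = bregman ds ?f Z X Y + Re (tensor_inner ds (Z' - Z) (X - Y))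
      + Re (tensor_inner ds (Z' - Z) (X' - X)) - bregman ds ?f Z X X'"
    by (simp add: bregman_def tensor_inner_diff_left tensor_inner_diff_right)
  moreover have "Re (tensor_inner ds (Z' - Z) (X' - X)) \<le>
      \<sigma> / 2 * (fro_norm ds (X - X'))\<^sup>2 + 1 / (2 * \<sigma>) * (fro_norm ds (Z' - Z))\<^sup>2"
    using young_tensor_inner[OF \<sigma>(2), of ds "Z' - Z" "X' - X"]
    by (simp add: fro_norm_def norm_minus_commute)
  moreover have "\<sigma> / 2 * (fro_norm ds (X - X'))\<^sup>2 \<le> bregman ds ?f Z X X'"
    unfolding \<sigma>(1) by (rule bregman_LSP_lower_bound[OF lam eps X X' Z])
  ultimately show ?thesis by linarith
qed

text \<open>
  Beyond \<open>2 \<bar>z\<bar>\<close> the quadratic term alone exceeds the value at 0, so it suffices to minimise over a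
  compact interval.
\<close>
lemma scalar_prox_exists:
  fixes z :: real
  assumes lam: "lam > 0" and eps: "\<epsilon> > 0"
  shows "\<exists>x::real. \<forall>y. lam * ln (1 + \<bar>x\<bar> / \<epsilon>) + 1/2 * (x - z)\<^sup>2 \<le> lam * ln (1 + \<bar>y\<bar> / \<epsilon>) + 1/2 * (y - z)\<^sup>2"
proof -
  define g where "g = (\<lambda>x::real. lam * ln (1 + \<bar>x\<bar> / \<epsilon>) + 1/2 * (x - z)\<^sup>2)"
  have "1 + \<bar>x\<bar> / \<epsilon> > 0" for x using eps by (intro add_pos_nonneg) auto
  then have "1 + \<bar>x\<bar> / \<epsilon> \<noteq> 0" for x by (metis less_irrefl)
  then have "continuous_on {- 2 * \<bar>z\<bar>..2 * \<bar>z\<bar>} g"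
    unfolding g_def using eps by (intro continuous_intros) auto
  then obtain x where "\<forall>y\<in>{- 2 * \<bar>z\<bar>..2 * \<bar>z\<bar>}. g x \<le> g y"
    using continuous_attains_inf[of "{- 2 * \<bar>z\<bar>..2 * \<bar>z\<bar>}" g] by auto
  then have x: "g x \<le> g y" if "y \<in> {- 2 * \<bar>z\<bar>..2 * \<bar>z\<bar>}" for y using that by blast
  have "g x \<le> g y" for y
  proof (cases "y \<in> {- 2 * \<bar>z\<bar>..2 * \<bar>z\<bar>}")
    case False
    then have "z\<^sup>2 \<le> (y - z)\<^sup>2" by (intro abs_le_square_iff[THEN iffD1]) auto
    moreover have "0 \<le> lam * ln (1 + \<bar>y\<bar> / \<epsilon>)" using lam eps by (intro mult_nonneg_nonneg ln_ge_zero) auto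
    ultimately have "g 0 \<le> g y" by (simp add: g_def)
    with x[of 0] show ?thesis by auto
  qed (rule x)
  then show ?thesis unfolding g_def by blast
qed

lemma prox_LSP_is_arg_min:
  assumes lam: "lam > 0" and eps: "\<epsilon> > 0" and Z: "Z \<in> real_tensors ds"
  shows "is_arg_min (\<lambda>X. lam * LSP ds \<epsilon> X + 1/2 * (fro_norm ds (X - Z))\<^sup>2) (\<lambda>X. X \<in> real_tensors ds)
    (prox_LSP ds lam \<epsilon> Z)"
proof -
  define g where "g = (\<lambda>z x::real. lam * ln (1 + \<bar>x\<bar> / \<epsilon>) + 1/2 * (x - z)\<^sup>2)"
  obtain x where x: "\<And>z y. g z (x z) \<le> g z y"
    using scalar_prox_exists[OF lam eps] unfolding g_def by metis
  define V where "V = (\<lambda>ix. if ix \<in> multi_indices ds then complex_of_real (x (Re (Z ix))) else 0)"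
  let ?G = "\<lambda>X. lam * LSP ds \<epsilon> X + 1/2 * (fro_norm ds (X - Z))\<^sup>2"
  \<comment> \<open>The objective separates into the entries.\<close>
  have G: "?G X = (\<Sum>ix\<in>multi_indices ds. g (Re (Z ix)) (Re (X ix)))" if "X \<in> real_tensors ds" for X
  proof -
    have "cmod (X ix) = \<bar>Re (X ix)\<bar>" "cmod (X ix - Z ix) = \<bar>Re (X ix) - Re (Z ix)\<bar>" for ix
      using that Z by (auto simp: real_tensors_def complex_is_Real_iff cmod_def)
    then show ?thesis
      by (simp add: LSP_def fro_norm_sq g_def sum.distrib sum_distrib_left sum_divide_distrib)
  qed
  have "V \<in> real_tensors ds" by (auto simp: V_def real_tensors_def tensors_def)
  moreover have "?G V \<le> ?G Y" if "Y \<in> real_tensors ds" for Y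
    unfolding G[OF \<open>V \<in> _\<close>] G[OF that] by (intro sum_mono) (simp add: V_def x)
  ultimately have "is_arg_min ?G (\<lambda>X. X \<in> real_tensors ds) V"
    by (auto simp: is_arg_min_def not_less)
  then show ?thesis unfolding prox_LSP_def arg_min_def
    by (rule someI[where P = "is_arg_min ?G (\<lambda>X. X \<in> real_tensors ds)"])
qed

lemma prox_LSP_real:
  assumes "lam > 0" "\<epsilon> > 0" "Z \<in> real_tensors ds"
  shows "prox_LSP ds lam \<epsilon> Z \<in> real_tensors ds"
  using prox_LSP_is_arg_min[OF assms] by (simp add: is_arg_min_def)

text \<open>
  Expanding the square turns the prox objective into \<open>f - \<langle>Z, \<cdot>\<rangle>\<close> plus a constant, and minimality of a
  point for this function is the subgradient inequality there.
\<close>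
lemma prox_LSP_subgradient:
  assumes "lam > 0" "\<epsilon> > 0" "Z \<in> real_tensors ds"
  shows "Z \<in> subdifferential ds (LSP_objective ds lam \<epsilon>) (prox_LSP ds lam \<epsilon> Z)"
proof -
  let ?P = "prox_LSP ds lam \<epsilon> Z" and ?f = "LSP_objective ds lam \<epsilon>"
  have G: "lam * LSP ds \<epsilon> X + 1/2 * (fro_norm ds (X - Z))\<^sup>2 =
      ?f X - Re (tensor_inner ds Z X) + 1/2 * (fro_norm ds Z)\<^sup>2" for X
    by (simp add: LSP_objective_def LSP_def sum_distrib_left fro_norm_sq_inner tensor_inner_diff_left
        tensor_inner_diff_right Re_tensor_inner_commute[of ds X Z] field_simps)
  have "?f Y \<ge> ?f ?P + Re (tensor_inner ds Z (Y - ?P))" if "Y \<in> real_tensors ds" for Y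
    using prox_LSP_is_arg_min[OF assms] that
    unfolding is_arg_min_def G by (auto simp: not_less tensor_inner_diff_right)
  then show ?thesis using assms(3) by (simp add: subdifferential_def)
qed

section \<open>One step of the iteration\<close>

context scaled_unitary_transform
begin

lemma t_prod_scale: "t_prod ns Us p q r A (\<lambda>ix. c * X ix) = (\<lambda>ix. c * t_prod ns Us p q r A X ix)"
  using t_prod_affine[of p q r A X "c - 1" X] by (simp add: algebra_simps)

lemma row_space_alt:
  "row_space ns Us n1 n2 l A =
    (\<lambda>Y. t_prod ns Us n2 n1 l (conj_transpose ns Us n1 n2 A) Y) ` real_tensors (n1 # l # ns)"
  by (auto simp: row_space_def)

lemma row_space_real:
  assumes "A \<in> real_tensors (n1 # n2 # ns)" "Z \<in> row_space ns Us n1 n2 l A"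
  shows "Z \<in> real_tensors (n2 # l # ns)"
  using assms conj_transpose_t_prod_real by (auto simp: row_space_def)

text \<open>
  Because \<open>B = A * Xhat\<close>, the residual of the selected slice is minus the slice of
  \<open>A * (X - Xhat)\<close>.  The step is thus expressed through the error and no longer through \<open>B\<close>.
\<close>
lemma kaczmarz_update_eq:
  fixes X :: tensor
  assumes j: "j < n1" and AX: "t_prod ns Us n1 n2 l A Xhat = B"
  defines "a \<equiv> (fro_norm (1 # n2 # ns) (hslice j A))\<^sup>2"
  defines "R \<equiv> hslice j (t_prod ns Us n1 n2 l A (X - Xhat))"
  shows "kaczmarz_update ns Us n2 l t A B j Z X =
    (\<lambda>ix. Z ix + of_real (- t / a) * t_prod ns Us n2 1 l (conj_transpose ns Us 1 n2 (hslice j A)) R ix)"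
proof -
  let ?P = "t_prod ns Us n2 1 l (conj_transpose ns Us 1 n2 (hslice j A))"
  define R' where "R' = hslice j B - t_prod ns Us 1 n2 l (hslice j A) X"
  have R': "R' ix = - R ix" for ix
    unfolding R'_def R_def hslice_t_prod[OF j] t_prod_diff AX hslice_diff by simp
  have "(\<lambda>ix. R' ix / of_real a) = (\<lambda>ix. of_real (- 1 / a) * R ix)"
    by (simp add: R')
  then have "?P (\<lambda>ix. R' ix / of_real a) = (\<lambda>ix. of_real (- 1 / a) * ?P R ix)"
    by (simp only: t_prod_scale)
  then show ?thesis
    unfolding kaczmarz_update_def Let_def R'_def[symmetric] a_def[symmetric] by simp
qed

lemma kaczmarz_update_row_space:
  assumes A: "A \<in> real_tensors (n1 # n2 # ns)" and j: "j < n1"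
    and AX: "t_prod ns Us n1 n2 l A Xhat = B"
    and X: "X \<in> real_tensors (n2 # l # ns)" and Xhat: "Xhat \<in> real_tensors (n2 # l # ns)"
    and Z: "Z \<in> row_space ns Us n1 n2 l A"
  shows "kaczmarz_update ns Us n2 l t A B j Z X \<in> row_space ns Us n1 n2 l A"
proof -
  define R where "R = hslice j (t_prod ns Us n1 n2 l A (X - Xhat))"
  define c where "c = - t / (fro_norm (1 # n2 # ns) (hslice j A))\<^sup>2"
  obtain Y where Y: "Y \<in> real_tensors (n1 # l # ns)"
    and Z_eq: "Z = t_prod ns Us n2 n1 l (conj_transpose ns Us n1 n2 A) Y"
    using Z by (auto simp: row_space_def)
  have "t_prod ns Us n1 n2 l A (X - Xhat) \<in> real_tensors (n1 # l # ns)"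
    using admissible A real_tensors_diff[OF X Xhat] by (auto simp: admissible_transform_def)
  then have R: "row_embedding j R \<in> real_tensors (n1 # l # ns)"
    unfolding R_def by (intro row_embedding_real_tensors[OF _ j] hslice_real_tensors)
  have "kaczmarz_update ns Us n2 l t A B j Z X = t_prod ns Us n2 n1 l (conj_transpose ns Us n1 n2 A)
      (\<lambda>ix. Y ix + of_real c * row_embedding j R ix)"
    unfolding kaczmarz_update_eq[OF j AX] t_prod_affine R_def[symmetric] c_def[symmetric]
      conj_transpose_hslice_t_prod[OF j] Z_eq ..
  moreover have "(\<lambda>ix. Y ix + of_real c * row_embedding j R ix) \<in> real_tensors (n1 # l # ns)"
    using Y R by (auto simp: real_tensors_def tensors_def)
  ultimately show ?thesis unfolding row_space_alt by (rule image_eqI)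
qed

text \<open>
  The linear term of \<open>bregman_LSP_step\<close> equals \<open>- t \<parallel>R\<parallel>\<^sup>2 / a\<close> by the adjoint property, and the quadratic
  one is at most \<open>t\<^sup>2 \<rho> \<parallel>R\<parallel>\<^sup>2 / (2 \<sigma> a)\<close> by the norm bound, where \<open>a = \<parallel>A(j)\<parallel>\<^sup>2\<close>.  The constant of the
  conclusion is \<open>1 / (2 \<sigma>) = \<epsilon>\<^sup>2 / (2 \<epsilon>\<^sup>2 - 2 lam)\<close>.
\<close>
lemma kaczmarz_bregman_decrease:
  assumes lam: "lam > 0" and eps: "\<epsilon> > 0" and lam_eps: "lam < \<epsilon>\<^sup>2"
    and A: "A \<in> real_tensors (n1 # n2 # ns)" and j: "j < n1" "hslice j A \<noteq> (\<lambda>_. 0)"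
    and AX: "t_prod ns Us n1 n2 l A Xhat = B"
    and X: "X \<in> real_tensors (n2 # l # ns)" and Xhat: "Xhat \<in> real_tensors (n2 # l # ns)"
    and Z: "Z \<in> subdifferential (n2 # l # ns) (LSP_objective (n2 # l # ns) lam \<epsilon>) X"
    and X': "X' \<in> real_tensors (n2 # l # ns)"
  shows "bregman (n2 # l # ns) (LSP_objective (n2 # l # ns) lam \<epsilon>) (kaczmarz_update ns Us n2 l t A B j Z X) X' Xhat
    \<le> bregman (n2 # l # ns) (LSP_objective (n2 # l # ns) lam \<epsilon>) Z X Xhat
      - t * (1 - t * \<rho> * \<epsilon>\<^sup>2 / (2 * \<epsilon>\<^sup>2 - 2 * lam))
        * (fro_norm (1 # l # ns) (hslice j (t_prod ns Us n1 n2 l A (X - Xhat))))\<^sup>2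
        / (fro_norm (1 # n2 # ns) (hslice j A))\<^sup>2"
proof -
  let ?ds = "n2 # l # ns"
  define a where "a = (fro_norm (1 # n2 # ns) (hslice j A))\<^sup>2"
  define R where "R = hslice j (t_prod ns Us n1 n2 l A (X - Xhat))"
  define r where "r = (fro_norm (1 # l # ns) R)\<^sup>2"
  define P where "P = t_prod ns Us n2 1 l (conj_transpose ns Us 1 n2 (hslice j A)) R"
  define \<sigma> where "\<sigma> = 1 - lam / \<epsilon>\<^sup>2"
  have \<sigma>: "\<sigma> > 0" using lam_eps eps by (simp add: \<sigma>_def field_simps)
  have "a \<noteq> 0"
    using fro_norm_eq_0[of "hslice j A" "1 # n2 # ns"] hslice_tensors[of A n1 "n2 # ns" j] A j(2)
    by (auto simp: a_def real_tensors_def)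
  then have a: "a > 0" by (simp add: a_def)
  have step: "kaczmarz_update ns Us n2 l t A B j Z X - Z = (\<lambda>ix. of_real (- t / a) * P ix)"
    unfolding kaczmarz_update_eq[OF j(1) AX] by (simp add: fun_eq_iff a_def R_def P_def)
  have "tensor_inner (1 # l # ns) R R = tensor_inner ?ds (X - Xhat) P"
    unfolding P_def t_prod_adjoint[symmetric] hslice_t_prod[OF j(1)] R_def[symmetric] ..
  then have "Re (tensor_inner ?ds P (X - Xhat)) = r"
    by (simp add: r_def fro_norm_sq_inner Re_tensor_inner_commute[of _ P])
  moreover have "tensor_inner ?ds (\<lambda>ix. of_real (- t / a) * P ix) (X - Xhat)
      = of_real (- t / a) * tensor_inner ?ds P (X - Xhat)"
    unfolding tensor_inner_def sum_distrib_left by (intro sum.cong refl) (rule mult.assoc)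
  moreover have "Re (of_real c * z) = c * Re z" for c :: real and z :: complex by simp
  ultimately have inner: "Re (tensor_inner ?ds (\<lambda>ix. of_real (- t / a) * P ix) (X - Xhat)) = - t / a * r"
    by presburger
  have "(fro_norm ?ds (\<lambda>ix. of_real (- t / a) * P ix))\<^sup>2 = (t / a)\<^sup>2 * (fro_norm ?ds P)\<^sup>2"
    by (simp add: fro_norm_sq norm_mult norm_divide power_mult_distrib power_divide sum_distrib_left)
  also have "\<dots> \<le> (t / a)\<^sup>2 * (\<rho> * a * r)"
    using fro_norm_t_prod_le[of n2 l 1 "conj_transpose ns Us 1 n2 (hslice j A)" R]
    unfolding fro_norm_conj_transpose P_def a_def r_def by (intro mult_left_mono) auto
  also have "\<dots> = t\<^sup>2 * \<rho> * r / a" using a by (simp add: power2_eq_square)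
  finally have norm: "(fro_norm ?ds (\<lambda>ix. of_real (- t / a) * P ix))\<^sup>2 \<le> t\<^sup>2 * \<rho> * r / a" .
  have "bregman ?ds (LSP_objective ?ds lam \<epsilon>) (kaczmarz_update ns Us n2 l t A B j Z X) X' Xhat
    \<le> bregman ?ds (LSP_objective ?ds lam \<epsilon>) Z X Xhat + - t / a * r
      + 1 / (2 * \<sigma>) * (fro_norm ?ds (\<lambda>ix. of_real (- t / a) * P ix))\<^sup>2"
    using bregman_LSP_step[OF lam eps \<sigma>_def \<sigma> X X' Z, of "kaczmarz_update ns Us n2 l t A B j Z X" Xhat]
    unfolding step inner .
  also have "\<dots> \<le> bregman ?ds (LSP_objective ?ds lam \<epsilon>) Z X Xhat + - t / a * r + 1 / (2 * \<sigma>) * (t\<^sup>2 * \<rho> * r / a)"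
    using norm \<sigma> by (intro add_left_mono mult_left_mono) auto
  also have "1 / (2 * \<sigma>) = \<epsilon>\<^sup>2 / (2 * \<epsilon>\<^sup>2 - 2 * lam)"
    using eps lam_eps by (simp add: \<sigma>_def field_simps)
  also have "d + - t / a * r + K * (t\<^sup>2 * \<rho> * r / a) = d - t * (1 - t * \<rho> * K) * r / a" for d K :: real
    using a by (simp add: field_simps power2_eq_square)
  finally show ?thesis
    unfolding a_def[symmetric] R_def[symmetric] r_def[symmetric] times_divide_eq_right .
qed

end

section \<open>Averaging over the random indices\<close>

text \<open>
  The latest index comes first, so that one step of the iteration is one \<open>Cons\<close>.
\<close>
fun recent_indices :: "(nat \<Rightarrow> 'w \<Rightarrow> nat) \<Rightarrow> nat \<Rightarrow> 'w \<Rightarrow> nat list" where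
  "recent_indices i 0 \<omega> = []"
| "recent_indices i (Suc k) \<omega> = i k \<omega> # recent_indices i k \<omega>"

lemma recent_indices_eq_iff:
  "recent_indices i k \<omega> = w \<longleftrightarrow> length w = k \<and> (\<forall>m<k. i m \<omega> = rev w ! m)"
proof (induction k arbitrary: w)
  case (Suc k)
  show ?case
  proof (cases w)
    case (Cons a v)
    then show ?thesis using Suc[of v] by (auto simp: nth_append less_Suc_eq)
  qed simp
qed auto

lemma prod_list_map_nth: "prod_list (map f w) = (\<Prod>m<length w. f (w ! m))"
  for f :: "'a \<Rightarrow> real"
  by (induction w) (simp_all add: prod.lessThan_Suc_shift del: prod.lessThan_Suc)

definition index_lists :: "nat \<Rightarrow> nat \<Rightarrow> nat list set" where
  "index_lists n k = {w. set w \<subseteq> {..<n} \<and> length w = k}"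

lemma finite_index_lists: "finite (index_lists n k)"
  unfolding index_lists_def by (rule finite_lists_length_eq) simp

lemma sum_index_lists_Suc:
  "(\<Sum>w\<in>index_lists n (Suc k). g w) = (\<Sum>w\<in>index_lists n k. \<Sum>j<n. g (j # w))"
proof -
  have "index_lists n (Suc k) = (\<lambda>(w, j). j # w) ` (index_lists n k \<times> {..<n})"
    by (auto simp: index_lists_def length_Suc_conv image_iff)
  then have "(\<Sum>w\<in>index_lists n (Suc k). g w) = (\<Sum>(w, j)\<in>index_lists n k \<times> {..<n}. g (j # w))"
    by (simp add: sum.reindex inj_on_def case_prod_unfold)
  then show ?thesis by (simp add: sum.cartesian_product)
qed

locale iid_indices = prob_space M for M :: "'w measure" +
  fixes i :: "nat \<Rightarrow> 'w \<Rightarrow> nat" and n :: nat and p :: "nat \<Rightarrow> real"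
  assumes indep: "indep_vars (\<lambda>_. count_space {..<n}) i UNIV"
    and distr: "\<And>k j. j < n \<Longrightarrow> prob {\<omega> \<in> space M. i k \<omega> = j} = p j"
begin

lemma i_measurable: "i k \<in> measurable M (count_space {..<n})"
  using indep by (simp add: indep_vars_def2)

lemma i_less: "\<omega> \<in> space M \<Longrightarrow> i k \<omega> < n"
  using measurable_space[OF i_measurable] by auto

lemma recent_indices_mem: "\<omega> \<in> space M \<Longrightarrow> recent_indices i k \<omega> \<in> index_lists n k"
  by (induction k) (auto simp: index_lists_def i_less)

lemma recent_indices_event:
  "{\<omega> \<in> space M. recent_indices i k \<omega> = w} \<in> events"
proof (cases "length w = k")
  case True
  have ev: "{\<omega> \<in> space M. i m \<omega> = j} \<in> events" for m j
  proof -
    have "{\<omega> \<in> space M. i m \<omega> = j} = i m -` ({j} \<inter> {..<n}) \<inter> space M"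
      using i_less by auto
    also have "\<dots> \<in> events" by (rule measurable_sets[OF i_measurable]) simp
    finally show ?thesis .
  qed
  have "{\<omega> \<in> space M. \<forall>m\<in>{..<k}. i m \<omega> = rev w ! m} \<in> events"
    by (rule sets.sets_Collect_finite_All) (rule ev, simp)
  also have "{\<omega> \<in> space M. \<forall>m\<in>{..<k}. i m \<omega> = rev w ! m} = {\<omega> \<in> space M. recent_indices i k \<omega> = w}"
    by (simp only: recent_indices_eq_iff True simp_thms lessThan_iff Ball_def)
  finally show ?thesis .
qed (simp add: recent_indices_eq_iff)

lemma prob_recent_indices:
  assumes w: "w \<in> index_lists n k"
  shows "prob {\<omega> \<in> space M. recent_indices i k \<omega> = w} = prod_list (map p w)"
proof (cases "k = 0")
  case True
  then show ?thesis using w by (simp add: index_lists_def prob_space)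
next
  case False
  have len: "length w = k" and lt: "\<And>m. m < k \<Longrightarrow> rev w ! m < n"
    using w nth_mem[of _ "rev w"] by (auto simp: index_lists_def)
  have ev: "i m -` {rev w ! m} \<inter> space M = {\<omega> \<in> space M. i m \<omega> = rev w ! m}" for m by auto
  have "{\<omega> \<in> space M. recent_indices i k \<omega> = w} = (\<Inter>m\<in>{..<k}. i m -` {rev w ! m} \<inter> space M)"
    using False len by (auto simp: recent_indices_eq_iff)
  also have "prob \<dots> = (\<Prod>m<k. prob (i m -` {rev w ! m} \<inter> space M))"
    using False lt by (intro indep_varsD_finite[OF indep_vars_subset[OF indep]]) auto
  also have "\<dots> = (\<Prod>m<k. p (rev w ! m))"
    unfolding ev by (intro prod.cong refl) (simp add: distr lt)
  also have "\<dots> = prod_list (map p (rev w))"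
    using len by (simp add: prod_list_map_nth)
  also have "\<dots> = prod_list (map p w)"
    by (simp only: rev_map[symmetric] prod_list.rev)
  finally show ?thesis .
qed

text \<open>
  A function of the first \<open>k\<close> indices is simple, so its expectation is a finite sum weighted by the
  product probabilities.
\<close>
lemma has_integral_recent_indices:
  fixes g :: "nat list \<Rightarrow> real"
  shows "has_bochner_integral M (\<lambda>\<omega>. g (recent_indices i k \<omega>))
    (\<Sum>w\<in>index_lists n k. prod_list (map p w) * g w)"
proof -
  let ?E = "\<lambda>w. {\<omega> \<in> space M. recent_indices i k \<omega> = w}"
  have "has_bochner_integral M (\<lambda>\<omega>. \<Sum>w\<in>index_lists n k. indicator (?E w) \<omega> * g w)
    (\<Sum>w\<in>index_lists n k. measure M (?E w) * g w)"
    by (intro has_bochner_integral_sum has_bochner_integral_mult_left has_bochner_integral_real_indicator)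
      (auto simp: recent_indices_event less_top[symmetric])
  also have "(\<Sum>w\<in>index_lists n k. measure M (?E w) * g w) =
      (\<Sum>w\<in>index_lists n k. prod_list (map p w) * g w)"
    by (intro sum.cong refl) (simp add: prob_recent_indices)
  also have "has_bochner_integral M (\<lambda>\<omega>. \<Sum>w\<in>index_lists n k. indicator (?E w) \<omega> * g w) y \<longleftrightarrow>
      has_bochner_integral M (\<lambda>\<omega>. g (recent_indices i k \<omega>)) y" for y
  proof (intro has_bochner_integral_cong refl)
    fix \<omega> assume "\<omega> \<in> space M"
    then show "(\<Sum>w\<in>index_lists n k. indicator (?E w) \<omega> * g w) = g (recent_indices i k \<omega>)"
      using recent_indices_mem[of \<omega> k]
      by (simp add: indicator_def finite_index_lists if_distrib[where f="\<lambda>x. x * _"] cong: if_cong)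
  qed
  finally show ?thesis .
qed

lemma integrable_recent_indices:
  fixes g :: "nat list \<Rightarrow> real"
  shows "integrable M (\<lambda>\<omega>. g (recent_indices i k \<omega>))"
  using has_integral_recent_indices by (rule integrable.intros)

text \<open>
  A contraction of the conditional mean given the past, required for every past separately, is
  inherited by the expectations: by the product formula the index added last is averaged against the
  weights \<open>p\<close>.
\<close>
lemma expectation_contraction:
  fixes g :: "nat list \<Rightarrow> real"
  assumes step: "\<And>w. w \<in> index_lists n k \<Longrightarrow> (\<Sum>j<n. p j * g (j # w)) \<le> c * g w"
    and p: "\<And>j. j < n \<Longrightarrow> 0 \<le> p j"
  shows "expectation (\<lambda>\<omega>. g (recent_indices i (Suc k) \<omega>)) \<le> c * expectation (\<lambda>\<omega>. g (recent_indices i k \<omega>))"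
proof -
  have "expectation (\<lambda>\<omega>. g (recent_indices i (Suc k) \<omega>))
      = (\<Sum>w\<in>index_lists n k. \<Sum>j<n. prod_list (map p (j # w)) * g (j # w))"
    using has_integral_recent_indices[of g "Suc k"]
    by (simp add: has_bochner_integral_iff sum_index_lists_Suc del: recent_indices.simps)
  also have "\<dots> = (\<Sum>w\<in>index_lists n k. prod_list (map p w) * (\<Sum>j<n. p j * g (j # w)))"
    by (simp add: sum_distrib_left ac_simps)
  also have "\<dots> \<le> (\<Sum>w\<in>index_lists n k. prod_list (map p w) * (c * g w))"
    using p by (intro sum_mono mult_left_mono step prod_list_nonneg) (auto simp: index_lists_def)
  also have "\<dots> = c * expectation (\<lambda>\<omega>. g (recent_indices i k \<omega>))"
    using has_integral_recent_indices[of g k]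
    by (simp add: has_bochner_integral_iff sum_distrib_left ac_simps)
  finally show ?thesis .
qed

end

section \<open>Linear convergence in expectation\<close>

theorem theorem3p13:
  fixes ns :: "nat list" and Us :: "complex Matrix.mat list" and n1 n2 l :: nat
    and A B Xhat Z0 X0 :: tensor
    and \<rho> lam \<epsilon> t \<nu> q :: real
    and f :: "tensor \<Rightarrow> real" and ds :: "nat list"
    and M :: "'w measure" and i :: "nat \<Rightarrow> 'w \<Rightarrow> nat"
    and Z X :: "nat \<Rightarrow> 'w \<Rightarrow> tensor"
  assumes dims: "ns \<noteq> []" "\<forall>n\<in>set ns. 0 < n" "0 < n1" "0 < n2" "0 < l"
    and L: "admissible_transform ns Us \<rho>"
    and A: "A \<in> real_tensors (n1 # n2 # ns)"
    and A_slices: "\<forall>j<n1. hslice j A \<noteq> (\<lambda>_. 0)"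
    and B: "B \<in> real_tensors (n1 # l # ns)"
    and ds: "ds = n2 # l # ns"
    and solvable: "\<exists>Y\<in>real_tensors ds. t_prod ns Us n1 n2 l A Y = B"
    and pos: "lam > 0" "\<epsilon> > 0" "t > 0" "\<nu> > 0"
    and f: "f = LSP_objective ds lam \<epsilon>"
    and Xhat: "is_arg_min f (\<lambda>Y. Y \<in> real_tensors ds \<and> t_prod ns Us n1 n2 l A Y = B) Xhat"
    and standing: "subdifferential ds f Xhat \<inter> row_space ns Us n1 n2 l A \<noteq> {}"
    and Z0: "Z0 \<in> row_space ns Us n1 n2 l A"
    and X0: "X0 = prox_LSP ds lam \<epsilon> Z0"
    and M: "prob_space M"
    and i_indep: "prob_space.indep_vars M (\<lambda>_. count_space {..<n1}) i UNIV"
    and i_distr: "\<forall>k. \<forall>j<n1. measure M {\<omega> \<in> space M. i k \<omega> = j} =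
      (fro_norm (1 # n2 # ns) (hslice j A))\<^sup>2 / (\<Sum>j'<n1. (fro_norm (1 # n2 # ns) (hslice j' A))\<^sup>2)"
    and init: "\<forall>\<omega>\<in>space M. Z 0 \<omega> = Z0 \<and> X 0 \<omega> = X0"
    and step: "\<forall>k. \<forall>\<omega>\<in>space M.
      Z (Suc k) \<omega> = kaczmarz_update ns Us n2 l t A B (i k \<omega>) (Z k \<omega>) (X k \<omega>) \<and>
      X (Suc k) \<omega> = prox_LSP ds lam \<epsilon> (Z (Suc k) \<omega>)"
    and params: "\<forall>k. \<forall>\<omega>\<in>space M. \<forall>ix\<in>multi_indices ds. (cmod (Z k \<omega> ix) + \<epsilon>)\<^sup>2 \<ge> 4 * lam"
    and nu: "\<forall>Y\<in>real_tensors ds. \<forall>W \<in> subdifferential ds f Y \<inter> row_space ns Us n1 n2 l A.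
      bregman ds f W Y Xhat \<le> bregman ds f Z0 X0 Xhat \<longrightarrow>
      bregman ds f W Y Xhat \<le> 1 / \<nu> * (fro_norm (n1 # l # ns) (t_prod ns Us n1 n2 l A (Y - Xhat)))\<^sup>2"
    and lam_eps: "sqrt lam < \<epsilon>"
    and q: "q = \<nu> * t / (fro_norm (n1 # n2 # ns) A)\<^sup>2 * (1 - t * \<rho> * \<epsilon>\<^sup>2 / (2 * \<epsilon>\<^sup>2 - 2 * lam))"
    and q_bounds: "0 < q" "q < 1"
  shows "\<forall>k. integrable M (\<lambda>\<omega>. bregman ds f (Z k \<omega>) (X k \<omega>) Xhat) \<and>
             integrable M (\<lambda>\<omega>. (fro_norm ds (X k \<omega> - Xhat))\<^sup>2) \<and>
             prob_space.expectation M (\<lambda>\<omega>. bregman ds f (Z (Suc k) \<omega>) (X (Suc k) \<omega>) Xhat)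
               \<le> (1 - q) * prob_space.expectation M (\<lambda>\<omega>. bregman ds f (Z k \<omega>) (X k \<omega>) Xhat) \<and>
             prob_space.expectation M (\<lambda>\<omega>. (fro_norm ds (X k \<omega> - Xhat))\<^sup>2)
               \<le> (2 * \<epsilon>\<^sup>2 / (\<epsilon>\<^sup>2 - lam) * bregman ds f Z0 X0 Xhat) * (1 - q) ^ k"
proof -
  interpret scaled_unitary_transform ns Us \<rho> by unfold_locales (rule L)
  define a where "a = (\<lambda>j. (fro_norm (1 # n2 # ns) (hslice j A))\<^sup>2)"
  define S where "S = (fro_norm (n1 # n2 # ns) A)\<^sup>2"
  define p where "p = (\<lambda>j. a j / S)"
  define \<beta> where "\<beta> = t * (1 - t * \<rho> * \<epsilon>\<^sup>2 / (2 * \<epsilon>\<^sup>2 - 2 * lam))"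
  define \<sigma> where "\<sigma> = 1 - lam / \<epsilon>\<^sup>2"
  have S_sum: "(\<Sum>j<n1. a j) = S"
    unfolding a_def S_def by (rule fro_norm_hslice_sum)
  have a_pos: "a j > 0" if "j < n1" for j
    using fro_norm_eq_0[of "hslice j A" "1 # n2 # ns"] hslice_tensors[of A n1 "n2 # ns" j] A A_slices that
    by (auto simp: a_def real_tensors_def)
  have S_pos: "S > 0"
    unfolding S_sum[symmetric] using dims(3) a_pos by (intro sum_pos) auto
  interpret iid_indices M i n1 p
    using M i_indep i_distr S_sum
    by (intro iid_indices.intro iid_indices_axioms.intro) (auto simp: p_def a_def)
  have lam_less: "lam < \<epsilon>\<^sup>2"
    using lam_eps pos by (metis less_eq_real_def real_less_rsqrt real_sqrt_less_iff real_sqrt_abs abs_of_pos)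
  have q_eq: "q = \<nu> * \<beta> / S" unfolding q \<beta>_def S_def by simp
  have \<beta>_pos: "\<beta> > 0"
    using q_bounds(1) S_pos pos(4) unfolding q_eq by (simp add: zero_less_divide_iff zero_less_mult_iff)
  have Xhat_real: "Xhat \<in> real_tensors ds" and AX: "t_prod ns Us n1 n2 l A Xhat = B"
    using Xhat by (auto simp: is_arg_min_def)

  \<comment> \<open>The iterates as deterministic functions of the list of past indices, latest index first.\<close>
  define run where "run = (\<lambda>w. foldr (\<lambda>j (U, V). let U' = kaczmarz_update ns Us n2 l t A B j U V
    in (U', prox_LSP ds lam \<epsilon> U')) w (Z0, X0))"
  define z where "z = (\<lambda>w. fst (run w))"
  define x where "x = (\<lambda>w. snd (run w))"
  define D where "D = (\<lambda>w. bregman ds f (z w) (x w) Xhat)"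
  have z_Nil: "z [] = Z0" and z_Cons: "z (j # w) = kaczmarz_update ns Us n2 l t A B j (z w) (x w)" for j w
    by (simp_all add: z_def x_def run_def Let_def case_prod_unfold)
  have x: "x w = prox_LSP ds lam \<epsilon> (z w)" for w
    by (cases w) (simp_all add: z_def x_def run_def X0 Let_def case_prod_unfold)
  have path: "Z k \<omega> = z (recent_indices i k \<omega>) \<and> X k \<omega> = x (recent_indices i k \<omega>)"
    if "\<omega> \<in> space M" for k \<omega>
    by (induction k) (use init step that in \<open>simp_all add: z_Nil z_Cons x X0\<close>)

  have z_row: "z w \<in> row_space ns Us n1 n2 l A" if "set w \<subseteq> {..<n1}" for w
    using that
  proof (induction w)
    case (Cons j w)
    then have w: "z w \<in> row_space ns Us n1 n2 l A" and j: "j < n1" by auto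
    have "x w \<in> real_tensors ds"
      unfolding x ds using row_space_real[OF A w] by (rule prox_LSP_real[OF pos(1,2)])
    with Xhat_real show ?case
      unfolding z_Cons ds by (intro kaczmarz_update_row_space[OF A j AX _ _ w])
  qed (simp add: z_Nil Z0)
  have x_real: "x w \<in> real_tensors ds" and z_sub: "z w \<in> subdifferential ds f (x w)"
    if "set w \<subseteq> {..<n1}" for w
    using row_space_real[OF A z_row[OF that]]
      prox_LSP_real[OF pos(1,2), of "z w" ds] prox_LSP_subgradient[OF pos(1,2), of "z w" ds]
    by (simp_all add: x f ds)

  define r where "r = (\<lambda>j w. (fro_norm (1 # l # ns) (hslice j (t_prod ns Us n1 n2 l A (x w - Xhat))))\<^sup>2)"
  have decrease: "D (j # w) \<le> D w - \<beta> * r j w / a j" if "set w \<subseteq> {..<n1}" "j < n1" for j w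
    using kaczmarz_bregman_decrease[OF pos(1,2) lam_less A that(2) _ AX, of "x w" "z w" "x (j # w)" t]
      x_real[of w] x_real[of "j # w"] z_sub[of w] Xhat_real A_slices that
    unfolding D_def z_Cons f ds \<beta>_def r_def a_def by auto
  \<comment> \<open>Monotonicity on every path keeps the iterates where the error bound with \<open>\<nu>\<close> is assumed.\<close>
  have D_le: "D w \<le> D []" if "set w \<subseteq> {..<n1}" for w
    using that
  proof (induction w)
    case (Cons j w)
    have "0 \<le> \<beta> * r j w / a j"
      using \<beta>_pos a_pos[of j] Cons.prems by (intro divide_nonneg_pos mult_nonneg_nonneg) (auto simp: r_def)
    with decrease[of w j] Cons show ?case by auto
  qed simp
  have error_bound: "\<nu> * D w \<le> (fro_norm (n1 # l # ns) (t_prod ns Us n1 n2 l A (x w - Xhat)))\<^sup>2"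
    if "set w \<subseteq> {..<n1}" for w
  proof -
    have "D [] = bregman ds f Z0 X0 Xhat" by (simp add: D_def z_Nil x X0)
    then have "D w \<le> 1 / \<nu> * (fro_norm (n1 # l # ns) (t_prod ns Us n1 n2 l A (x w - Xhat)))\<^sup>2"
      using nu x_real[OF that] z_sub[OF that] z_row[OF that] D_le[OF that] unfolding D_def by auto
    then show ?thesis using pos(4) by (simp add: field_simps)
  qed
  have averaged: "(\<Sum>j<n1. p j * D (j # w)) \<le> (1 - q) * D w" if "set w \<subseteq> {..<n1}" for w
  proof -
    have "(\<Sum>j<n1. p j * D (j # w)) \<le> (\<Sum>j<n1. p j * (D w - \<beta> * r j w / a j))"
      using decrease[OF that] a_pos S_pos by (intro sum_mono mult_left_mono) (auto simp: p_def less_imp_le)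
    \<comment> \<open>The sampling weights cancel the normalisation of the step.\<close>
    also have "\<dots> = (\<Sum>j<n1. a j * (D w / S) - \<beta> / S * r j w)"
    proof (rule sum.cong[OF refl])
      fix j assume "j \<in> {..<n1}"
      then have "a j \<noteq> 0" using a_pos[of j] by auto
      then show "p j * (D w - \<beta> * r j w / a j) = a j * (D w / S) - \<beta> / S * r j w"
        using S_pos by (simp add: p_def field_simps)
    qed
    also have "\<dots> = (\<Sum>j<n1. a j) * (D w / S) - \<beta> / S * (\<Sum>j<n1. r j w)"
      by (simp only: sum_subtractf sum_distrib_left sum_distrib_right)
    also have "\<dots> = D w - \<beta> / S * (fro_norm (n1 # l # ns) (t_prod ns Us n1 n2 l A (x w - Xhat)))\<^sup>2"
      unfolding S_sum r_def fro_norm_hslice_sum using S_pos by simp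
    also have "\<dots> \<le> D w - \<beta> / S * (\<nu> * D w)"
      using error_bound[OF that] \<beta>_pos S_pos by (intro diff_left_mono mult_left_mono) auto
    also have "\<dots> = (1 - q) * D w" by (simp add: q_eq algebra_simps)
    finally show ?thesis .
  qed

  let ?G = "\<lambda>w. (fro_norm ds (x w - Xhat))\<^sup>2"
  have E_cong: "expectation (\<lambda>\<omega>. bregman ds f (Z k \<omega>) (X k \<omega>) Xhat) = expectation (\<lambda>\<omega>. D (recent_indices i k \<omega>))"
    "expectation (\<lambda>\<omega>. (fro_norm ds (X k \<omega> - Xhat))\<^sup>2) = expectation (\<lambda>\<omega>. ?G (recent_indices i k \<omega>))"
    "integrable M (\<lambda>\<omega>. bregman ds f (Z k \<omega>) (X k \<omega>) Xhat)"
    "integrable M (\<lambda>\<omega>. (fro_norm ds (X k \<omega> - Xhat))\<^sup>2)" for k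
    using integrable_recent_indices[of D k] integrable_recent_indices[of ?G k]
    by (auto simp: path D_def cong: Bochner_Integration.integral_cong Bochner_Integration.integrable_cong)
  have contraction: "expectation (\<lambda>\<omega>. D (recent_indices i (Suc k) \<omega>)) \<le>
      (1 - q) * expectation (\<lambda>\<omega>. D (recent_indices i k \<omega>))" for k
    using averaged a_pos S_pos
    by (intro expectation_contraction) (auto simp: index_lists_def p_def less_imp_le)
  have rate: "expectation (\<lambda>\<omega>. D (recent_indices i k \<omega>)) \<le> D [] * (1 - q) ^ k" for k
  proof (induction k)
    case 0
    show ?case by (simp add: prob_space)
  next
    case (Suc k)
    have "(1 - q) * expectation (\<lambda>\<omega>. D (recent_indices i k \<omega>)) \<le> (1 - q) * (D [] * (1 - q) ^ k)"
      using Suc q_bounds by (intro mult_left_mono) auto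
    with contraction[of k] show ?case by (simp add: ac_simps)
  qed
  have c: "2 / \<sigma> = 2 * \<epsilon>\<^sup>2 / (\<epsilon>\<^sup>2 - lam)" and c_nonneg: "0 \<le> 2 / \<sigma>"
    using lam_less pos by (auto simp: \<sigma>_def field_simps)
  have "?G w \<le> 2 / \<sigma> * D w" if "set w \<subseteq> {..<n1}" for w
  proof -
    have "\<sigma> / 2 * ?G w \<le> D w"
      using bregman_LSP_lower_bound[OF pos(1,2) x_real[OF that] Xhat_real] z_sub[OF that]
      by (simp add: D_def f \<sigma>_def)
    moreover have "\<sigma> > 0" using lam_less pos by (simp add: \<sigma>_def field_simps)
    ultimately show ?thesis by (simp add: field_simps)
  qed
  then have "expectation (\<lambda>\<omega>. ?G (recent_indices i k \<omega>)) \<le> 2 / \<sigma> * expectation (\<lambda>\<omega>. D (recent_indices i k \<omega>))" for k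
    unfolding integral_mult_right_zero[symmetric]
    using integrable_recent_indices[of ?G k] integrable_recent_indices[of "\<lambda>w. 2 / \<sigma> * D w" k] recent_indices_mem[of _ k]
    by (intro integral_mono) (auto simp: index_lists_def)
  then have "expectation (\<lambda>\<omega>. ?G (recent_indices i k \<omega>)) \<le> 2 / \<sigma> * (D [] * (1 - q) ^ k)" for k
    using mult_left_mono[OF rate c_nonneg] by (rule order_trans)
  moreover have "D [] = bregman ds f Z0 X0 Xhat" by (simp add: D_def z_Nil x X0)
  ultimately show ?thesis
    unfolding E_cong(1,2) using E_cong(3,4) contraction by (simp add: c mult.assoc)
qed

end
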